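(* Let $\Gamma=(\mathbb{C},\mathbb{X},I,H,\eta,\epsilon,\mathcal{E},\mathcal{F})$ be an admissible Galois structure in which $\mathcal{E}$ and $\mathcal{F}$ are the classes of all regular epimorphisms of $\mathbb{C}$ and of $\mathbb{X}$ respectively, and such that $\mathrm{Norm}(\mathbb{C})$ is closed under coequalisers of reflexive graphs in $\mathrm{Fib}(\mathbb{C})$ (that is, the coequaliser in $\mathrm{Fib}(\mathbb{C})$ of any reflexive graph in $\mathrm{Fib}(\mathbb{C})$ between two normal extensions is again a normal extension). Then, for any object $B$ of $\mathbb{C}$, $\mathrm{Norm}(B)$ is a reflective subcategory of $(\mathcal{E}\downarrow B)$. As a consequence, normal extensions are reflective amongst fibrations, i.e. $\mathrm{Norm}(\mathbb{C})$ is a reflective subcategory of $\mathrm{Fib}(\mathbb{C})$.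
   Context: A Galois structure $\Gamma=(\mathbb{C},\mathbb{X},I,H,\eta,\epsilon,\mathcal{E},\mathcal{F})$ consists of an adjunction $I\dashv H$, $I\colon\mathbb{C}\to\mathbb{X}$, $H\colon\mathbb{X}\to\mathbb{C}$, with unit $\eta\colon 1_{\mathbb{C}}\Rightarrow HI$ and counit $\epsilon\colon IH\Rightarrow 1_{\mathbb{X}}$, between Barr-exact categories $\mathbb{C}$ and $\mathbb{X}$, and classes of morphisms $\mathcal{E}$ in $\mathbb{C}$ and $\mathcal{F}$ in $\mathbb{X}$ (called fibrations) such that: $\mathcal{E}$ and $\mathcal{F}$ contain all isomorphisms, are pullback-stable and are closed under composition; $H(\mathcal{F})\subseteq\mathcal{E}$ and $I(\mathcal{E})\subseteq\mathcal{F}$; $\mathcal{E}$ and $\mathcal{F}$ consist of the regular epimorphisms in $\mathbb{C}$ and $\mathbb{X}$, respectively. It is moreover assumed that $\mathbb{C}$ has coequalisers of reflexive graphs (a reflexive graph is a pair of parallel morphisms with a common section). For an object $B$, $(\mathcal{E}\downarrow B)$ is the full subcategory of the slice category $(\mathbb{C}\downarrow B)$ determined by the morphisms in $\mathcal{E}$; similarly for $(\mathcal{F}\downarrow I(B))$. The functor $H^B\colon(\mathcal{F}\downarrow I(B))\to(\mathcal{E}\downarrow B)$ sends a fibration $g\colon X\to I(B)$ to the pullback of $H(g)\colon H(X)\to HI(B)$ along $\eta_B\colon B\to HI(B)$. $\Gamma$ is admissible when $H^B$ is full and faithful for every object $B$ of $\mathbb{C}$. A trivial extension is a fibration $f\colon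 A\to B$ in $\mathbb{C}$ such that the naturality square $HI(f)\circ\eta_A=\eta_B\circ f$ is a pullback. A normal extension is a fibration in $\mathbb{C}$ whose kernel pair projections are trivial extensions. $\mathrm{Fib}(\mathbb{C})$ is the full subcategory of the category of arrows of $\mathbb{C}$ determined by the fibrations (morphisms in $\mathcal{E}$); $\mathrm{Norm}(\mathbb{C})$ is the full subcategory of $\mathrm{Fib}(\mathbb{C})$ determined by the normal extensions; $\mathrm{Norm}(B)$ is the full subcategory of $(\mathcal{E}\downarrow B)$ determined by the normal extensions over $B$. *)

theory Defs
  imports Main
begin

section \<open>Categories, functors and adjunctions\<close>

text \<open>
  A category is given by carrier sets of objects and arrows inside two types. Composition is
  written in applicative order, and its value is only relevant on composable pairs of arrows.
\<close>

record ('o, 'a) cat =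
  obj :: "'o set"
  arr :: "'a set"
  src :: "'a \<Rightarrow> 'o"
  tgt :: "'a \<Rightarrow> 'o"
  ide :: "'o \<Rightarrow> 'a"
  cmp :: "'a \<Rightarrow> 'a \<Rightarrow> 'a" (infixl "\<cdot>\<index>" 70)

definition hom :: "('o, 'a, 'm) cat_scheme \<Rightarrow> 'o \<Rightarrow> 'o \<Rightarrow> 'a set" where
  "hom C a b = {f \<in> arr C. src C f = a \<and> tgt C f = b}"

locale category =
  fixes C :: "('o, 'a) cat" (structure)
  assumes src_obj: "f \<in> arr C \<Longrightarrow> src C f \<in> obj C"
    and tgt_obj: "f \<in> arr C \<Longrightarrow> tgt C f \<in> obj C"
    and ide_hom: "a \<in> obj C \<Longrightarrow> ide C a \<in> hom C a a"
    and cmp_hom: "\<lbrakk>f \<in> hom C a b; g \<in> hom C b c\<rbrakk> \<Longrightarrow> g \<cdot> f \<in> hom C a c"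
    and cmp_ide_right: "f \<in> hom C a b \<Longrightarrow> f \<cdot> ide C a = f"
    and cmp_ide_left: "f \<in> hom C a b \<Longrightarrow> ide C b \<cdot> f = f"
    and cmp_assoc: "\<lbrakk>f \<in> hom C a b; g \<in> hom C b c; h \<in> hom C c d\<rbrakk> \<Longrightarrow> (h \<cdot> g) \<cdot> f = h \<cdot> (g \<cdot> f)"

record ('o, 'a, 'p, 'b) fctr =
  omap :: "'o \<Rightarrow> 'p"
  amap :: "'a \<Rightarrow> 'b"

definition is_functor :: "('o, 'a) cat \<Rightarrow> ('p, 'b) cat \<Rightarrow> ('o, 'a, 'p, 'b) fctr \<Rightarrow> bool" where
  "is_functor C D F \<longleftrightarrow>
     category C \<and> category D \<and>
     (\<forall>a \<in> obj C. omap F a \<in> obj D) \<and>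
     (\<forall>f \<in> arr C. amap F f \<in> hom D (omap F (src C f)) (omap F (tgt C f))) \<and>
     (\<forall>a \<in> obj C. amap F (ide C a) = ide D (omap F a)) \<and>
     (\<forall>f \<in> arr C. \<forall>g \<in> arr C. tgt C f = src C g \<longrightarrow>
        amap F (g \<cdot>\<^bsub>C\<^esub> f) = amap F g \<cdot>\<^bsub>D\<^esub> amap F f)"

definition id_fctr :: "('o, 'a, 'o, 'a) fctr" where
  "id_fctr = \<lparr>omap = (\<lambda>a. a), amap = (\<lambda>f. f)\<rparr>"

definition comp_fctr ::
  "('p, 'b, 'q, 'c) fctr \<Rightarrow> ('o, 'a, 'p, 'b) fctr \<Rightarrow> ('o, 'a, 'q, 'c) fctr" where
  "comp_fctr G F = \<lparr>omap = omap G \<circ> omap F, amap = amap G \<circ> amap F\<rparr>"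

definition fully_faithful ::
  "('o, 'a) cat \<Rightarrow> ('p, 'b) cat \<Rightarrow> ('o, 'a, 'p, 'b) fctr \<Rightarrow> bool" where
  "fully_faithful C D F \<longleftrightarrow>
     (\<forall>a \<in> obj C. \<forall>b \<in> obj C. bij_betw (amap F) (hom C a b) (hom D (omap F a) (omap F b)))"

definition nat_trans ::
  "('o, 'a) cat \<Rightarrow> ('p, 'b) cat \<Rightarrow> ('o, 'a, 'p, 'b) fctr \<Rightarrow> ('o, 'a, 'p, 'b) fctr \<Rightarrow> ('o \<Rightarrow> 'b) \<Rightarrow> bool"
  where
  "nat_trans C D F G \<tau> \<longleftrightarrow>
     is_functor C D F \<and> is_functor C D G \<and>
     (\<forall>a \<in> obj C. \<tau> a \<in> hom D (omap F a) (omap G a)) \<and>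
     (\<forall>f \<in> arr C. \<tau> (tgt C f) \<cdot>\<^bsub>D\<^esub> amap F f = amap G f \<cdot>\<^bsub>D\<^esub> \<tau> (src C f))"

text \<open>\<open>I \<stileturn> H\<close> with unit \<open>\<eta>\<close> and counit \<open>\<epsilon>\<close>; the last two conditions are the triangle identities.\<close>

definition adjunction ::
  "('o, 'a) cat \<Rightarrow> ('p, 'b) cat \<Rightarrow> ('o, 'a, 'p, 'b) fctr \<Rightarrow> ('p, 'b, 'o, 'a) fctr
     \<Rightarrow> ('o \<Rightarrow> 'a) \<Rightarrow> ('p \<Rightarrow> 'b) \<Rightarrow> bool" where
  "adjunction C X I H \<eta> \<epsilon> \<longleftrightarrow>
     is_functor C X I \<and> is_functor X C H \<and>
     nat_trans C C id_fctr (comp_fctr H I) \<eta> \<and>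
     nat_trans X X (comp_fctr I H) id_fctr \<epsilon> \<and>
     (\<forall>a \<in> obj C. \<epsilon> (omap I a) \<cdot>\<^bsub>X\<^esub> amap I (\<eta> a) = ide X (omap I a)) \<and>
     (\<forall>x \<in> obj X. amap H (\<epsilon> x) \<cdot>\<^bsub>C\<^esub> \<eta> (omap H x) = ide C (omap H x))"

definition full_subcat :: "('o, 'a) cat \<Rightarrow> 'o set \<Rightarrow> ('o, 'a) cat" where
  "full_subcat C S = C\<lparr>obj := obj C \<inter> S, arr := {f \<in> arr C. src C f \<in> S \<and> tgt C f \<in> S}\<rparr>"

definition is_subcategory :: "('o, 'a) cat \<Rightarrow> ('o, 'a) cat \<Rightarrow> bool" where
  "is_subcategory D C \<longleftrightarrow>
     category D \<and> category C \<and> obj D \<subseteq> obj C \<and> arr D \<subseteq> arr C \<and>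
     (\<forall>f \<in> arr D. src D f = src C f \<and> tgt D f = tgt C f) \<and>
     (\<forall>a \<in> obj D. ide D a = ide C a) \<and>
     (\<forall>f \<in> arr D. \<forall>g \<in> arr D. tgt D f = src D g \<longrightarrow> g \<cdot>\<^bsub>D\<^esub> f = g \<cdot>\<^bsub>C\<^esub> f)"

text \<open>\<open>id_fctr\<close>, read as a functor from \<open>D\<close> to \<open>C\<close>, is the inclusion.\<close>

definition reflective_subcategory :: "('o, 'a) cat \<Rightarrow> ('o, 'a) cat \<Rightarrow> bool" where
  "reflective_subcategory D C \<longleftrightarrow>
     is_subcategory D C \<and> (\<exists>L \<eta> \<epsilon>. adjunction C D L id_fctr \<eta> \<epsilon>)"


section \<open>Limits, colimits and exactness\<close>

definition is_iso :: "('o, 'a) cat \<Rightarrow> 'a \<Rightarrow> bool" where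
  "is_iso C f \<longleftrightarrow> f \<in> arr C \<and>
     (\<exists>g \<in> hom C (tgt C f) (src C f).
        g \<cdot>\<^bsub>C\<^esub> f = ide C (src C f) \<and> f \<cdot>\<^bsub>C\<^esub> g = ide C (tgt C f))"

definition is_terminal :: "('o, 'a) cat \<Rightarrow> 'o \<Rightarrow> bool" where
  "is_terminal C t \<longleftrightarrow> t \<in> obj C \<and> (\<forall>a \<in> obj C. \<exists>!f. f \<in> hom C a t)"

text \<open>
  \<open>is_pullback C p q f g\<close> says that the commutative square \<open>f p = g q\<close> is a pullback; thus \<open>p\<close> is
  the pullback of \<open>g\<close> along \<open>f\<close>.
\<close>

definition is_pullback :: "('o, 'a) cat \<Rightarrow> 'a \<Rightarrow> 'a \<Rightarrow> 'a \<Rightarrow> 'a \<Rightarrow> bool" where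
  "is_pullback C p q f g \<longleftrightarrow>
     p \<in> arr C \<and> q \<in> arr C \<and> f \<in> arr C \<and> g \<in> arr C \<and>
     src C p = src C q \<and> tgt C p = src C f \<and> tgt C q = src C g \<and> tgt C f = tgt C g \<and>
     f \<cdot>\<^bsub>C\<^esub> p = g \<cdot>\<^bsub>C\<^esub> q \<and>
     (\<forall>a \<in> obj C. \<forall>u \<in> hom C a (src C f). \<forall>v \<in> hom C a (src C g).
        f \<cdot>\<^bsub>C\<^esub> u = g \<cdot>\<^bsub>C\<^esub> v \<longrightarrow>
        (\<exists>!w. w \<in> hom C a (src C p) \<and> p \<cdot>\<^bsub>C\<^esub> w = u \<and> q \<cdot>\<^bsub>C\<^esub> w = v))"

definition has_pullbacks :: "('o, 'a) cat \<Rightarrow> bool" where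
  "has_pullbacks C \<longleftrightarrow>
     (\<forall>f \<in> arr C. \<forall>g \<in> arr C. tgt C f = tgt C g \<longrightarrow> (\<exists>p q. is_pullback C p q f g))"

definition finitely_complete :: "('o, 'a) cat \<Rightarrow> bool" where
  "finitely_complete C \<longleftrightarrow> (\<exists>t. is_terminal C t) \<and> has_pullbacks C"

definition is_kernel_pair :: "('o, 'a) cat \<Rightarrow> 'a \<Rightarrow> 'a \<Rightarrow> 'a \<Rightarrow> bool" where
  "is_kernel_pair C p q f \<longleftrightarrow> is_pullback C p q f f"

definition is_coequaliser :: "('o, 'a) cat \<Rightarrow> 'a \<Rightarrow> 'a \<Rightarrow> 'a \<Rightarrow> bool" where
  "is_coequaliser C x y q \<longleftrightarrow>
     x \<in> arr C \<and> y \<in> arr C \<and> q \<in> arr C \<and>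
     src C x = src C y \<and> tgt C x = tgt C y \<and> src C q = tgt C x \<and>
     q \<cdot>\<^bsub>C\<^esub> x = q \<cdot>\<^bsub>C\<^esub> y \<and>
     (\<forall>c \<in> obj C. \<forall>u \<in> hom C (tgt C x) c. u \<cdot>\<^bsub>C\<^esub> x = u \<cdot>\<^bsub>C\<^esub> y \<longrightarrow>
        (\<exists>!w. w \<in> hom C (tgt C q) c \<and> w \<cdot>\<^bsub>C\<^esub> q = u))"

definition regular_epis :: "('o, 'a) cat \<Rightarrow> 'a set" where
  "regular_epis C = {q. \<exists>x y. is_coequaliser C x y q}"

definition pullback_stable :: "('o, 'a) cat \<Rightarrow> 'a set \<Rightarrow> bool" where
  "pullback_stable C E \<longleftrightarrow> (\<forall>p q f g. is_pullback C p q f g \<and> g \<in> E \<longrightarrow> p \<in> E)"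

definition regular_category :: "('o, 'a) cat \<Rightarrow> bool" where
  "regular_category C \<longleftrightarrow>
     category C \<and> finitely_complete C \<and>
     (\<forall>p q f. is_kernel_pair C p q f \<longrightarrow> (\<exists>c. is_coequaliser C p q c)) \<and>
     pullback_stable C (regular_epis C)"

text \<open>
  An internal equivalence relation on an object \<open>a\<close>: a jointly monic pair \<open>r\<^sub>1, r\<^sub>2\<close> of arrows into
  \<open>a\<close> which is reflexive, symmetric and transitive. In the transitivity condition the pullback
  \<open>(p, q)\<close> is the object of pairs \<open>x R y R z\<close>.
\<close>

definition is_internal_equivalence :: "('o, 'a) cat \<Rightarrow> 'a \<Rightarrow> 'a \<Rightarrow> bool" where
  "is_internal_equivalence C r1 r2 \<longleftrightarrow>
     r1 \<in> arr C \<and> r2 \<in> arr C \<and> src C r1 = src C r2 \<and> tgt C r1 = tgt C r2 \<and>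
     (\<forall>a \<in> obj C. \<forall>u \<in> hom C a (src C r1). \<forall>v \<in> hom C a (src C r1).
        r1 \<cdot>\<^bsub>C\<^esub> u = r1 \<cdot>\<^bsub>C\<^esub> v \<and> r2 \<cdot>\<^bsub>C\<^esub> u = r2 \<cdot>\<^bsub>C\<^esub> v \<longrightarrow> u = v) \<and>
     (\<exists>d \<in> hom C (tgt C r1) (src C r1).
        r1 \<cdot>\<^bsub>C\<^esub> d = ide C (tgt C r1) \<and> r2 \<cdot>\<^bsub>C\<^esub> d = ide C (tgt C r1)) \<and>
     (\<exists>s \<in> hom C (src C r1) (src C r1). r1 \<cdot>\<^bsub>C\<^esub> s = r2 \<and> r2 \<cdot>\<^bsub>C\<^esub> s = r1) \<and>
     (\<forall>p q. is_pullback C p q r2 r1 \<longrightarrow>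
        (\<exists>t \<in> hom C (src C p) (src C r1).
           r1 \<cdot>\<^bsub>C\<^esub> t = r1 \<cdot>\<^bsub>C\<^esub> p \<and> r2 \<cdot>\<^bsub>C\<^esub> t = r2 \<cdot>\<^bsub>C\<^esub> q))"

definition barr_exact :: "('o, 'a) cat \<Rightarrow> bool" where
  "barr_exact C \<longleftrightarrow>
     regular_category C \<and>
     (\<forall>r1 r2. is_internal_equivalence C r1 r2 \<longrightarrow> (\<exists>f. is_kernel_pair C r1 r2 f))"

definition is_reflexive_graph :: "('o, 'a) cat \<Rightarrow> 'a \<Rightarrow> 'a \<Rightarrow> bool" where
  "is_reflexive_graph C x y \<longleftrightarrow>
     x \<in> arr C \<and> y \<in> arr C \<and> src C x = src C y \<and> tgt C x = tgt C y \<and>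
     (\<exists>s \<in> hom C (tgt C x) (src C x).
        x \<cdot>\<^bsub>C\<^esub> s = ide C (tgt C x) \<and> y \<cdot>\<^bsub>C\<^esub> s = ide C (tgt C x))"

definition has_reflexive_coequalisers :: "('o, 'a) cat \<Rightarrow> bool" where
  "has_reflexive_coequalisers C \<longleftrightarrow>
     (\<forall>x y. is_reflexive_graph C x y \<longrightarrow> (\<exists>q. is_coequaliser C x y q))"

definition closed_under_reflexive_coequalisers :: "('o, 'a) cat \<Rightarrow> ('o, 'a) cat \<Rightarrow> bool" where
  "closed_under_reflexive_coequalisers D C \<longleftrightarrow>
     (\<forall>x y q. is_reflexive_graph C x y \<and> src C x \<in> obj D \<and> tgt C x \<in> obj D \<and>
        is_coequaliser C x y q \<longrightarrow> tgt C q \<in> obj D)"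


section \<open>Slice categories and categories of arrows\<close>

text \<open>An arrow \<open>(f, h, g)\<close> of the slice over \<open>b\<close> is the arrow \<open>h\<close> from \<open>f\<close> to \<open>g\<close>, with \<open>g h = f\<close>.\<close>

definition slice :: "('o, 'a) cat \<Rightarrow> 'o \<Rightarrow> ('a, 'a \<times> 'a \<times> 'a) cat" where
  "slice C b = \<lparr>
     obj = {f \<in> arr C. tgt C f = b},
     arr = {(f, h, g). f \<in> arr C \<and> tgt C f = b \<and> g \<in> arr C \<and> tgt C g = b \<and>
              h \<in> hom C (src C f) (src C g) \<and> g \<cdot>\<^bsub>C\<^esub> h = f},
     src = (\<lambda>(f, h, g). f),
     tgt = (\<lambda>(f, h, g). g),
     ide = (\<lambda>f. (f, ide C (src C f), f)),
     cmp = (\<lambda>(f', k, g') (f, h, g). (f, k \<cdot>\<^bsub>C\<^esub> h, g'))\<rparr>"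

text \<open>
  An arrow \<open>(f, h, k, g)\<close> of the arrow category is the commutative square \<open>k f = g h\<close> from \<open>f\<close> to
  \<open>g\<close>, with top \<open>h\<close> and bottom \<open>k\<close>.
\<close>

definition arrow_cat :: "('o, 'a) cat \<Rightarrow> ('a, 'a \<times> 'a \<times> 'a \<times> 'a) cat" where
  "arrow_cat C = \<lparr>
     obj = arr C,
     arr = {(f, h, k, g). f \<in> arr C \<and> g \<in> arr C \<and> h \<in> hom C (src C f) (src C g) \<and>
              k \<in> hom C (tgt C f) (tgt C g) \<and> k \<cdot>\<^bsub>C\<^esub> f = g \<cdot>\<^bsub>C\<^esub> h},
     src = (\<lambda>(f, h, k, g). f),
     tgt = (\<lambda>(f, h, k, g). g),
     ide = (\<lambda>f. (f, ide C (src C f), ide C (tgt C f), f)),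
     cmp = (\<lambda>(f', h', k', g') (f, h, k, g). (f, h' \<cdot>\<^bsub>C\<^esub> h, k' \<cdot>\<^bsub>C\<^esub> k, g'))\<rparr>"


section \<open>Galois structures\<close>

record ('o, 'a, 'p, 'b) galois =
  catC :: "('o, 'a) cat"
  catX :: "('p, 'b) cat"
  fI :: "('o, 'a, 'p, 'b) fctr"
  fH :: "('p, 'b, 'o, 'a) fctr"
  unit :: "'o \<Rightarrow> 'a"
  counit :: "'p \<Rightarrow> 'b"
  fibE :: "'a set"
  fibF :: "'b set"

definition fibration_class :: "('o, 'a) cat \<Rightarrow> 'a set \<Rightarrow> bool" where
  "fibration_class C E \<longleftrightarrow>
     E \<subseteq> arr C \<and> {f. is_iso C f} \<subseteq> E \<and> pullback_stable C E \<and>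
     (\<forall>f \<in> E. \<forall>g \<in> E. tgt C f = src C g \<longrightarrow> g \<cdot>\<^bsub>C\<^esub> f \<in> E)"

text \<open>
  That the fibrations are the regular epimorphisms is not part of this definition; it is a separate
  hypothesis, as is the existence of coequalisers of reflexive graphs.
\<close>

definition galois_structure :: "('o, 'a, 'p, 'b) galois \<Rightarrow> bool" where
  "galois_structure \<Gamma> \<longleftrightarrow>
     barr_exact (catC \<Gamma>) \<and> barr_exact (catX \<Gamma>) \<and>
     adjunction (catC \<Gamma>) (catX \<Gamma>) (fI \<Gamma>) (fH \<Gamma>) (unit \<Gamma>) (counit \<Gamma>) \<and>
     fibration_class (catC \<Gamma>) (fibE \<Gamma>) \<and> fibration_class (catX \<Gamma>) (fibF \<Gamma>) \<and>
     amap (fH \<Gamma>) ` fibF \<Gamma> \<subseteq> fibE \<Gamma> \<and> amap (fI \<Gamma>) ` fibE \<Gamma> \<subseteq> fibF \<Gamma>"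

definition Fib_over :: "('o, 'a, 'p, 'b) galois \<Rightarrow> 'o \<Rightarrow> ('a, 'a \<times> 'a \<times> 'a) cat" where
  "Fib_over \<Gamma> B = full_subcat (slice (catC \<Gamma>) B) (fibE \<Gamma>)"

definition FibX_over :: "('o, 'a, 'p, 'b) galois \<Rightarrow> 'p \<Rightarrow> ('b, 'b \<times> 'b \<times> 'b) cat" where
  "FibX_over \<Gamma> Y = full_subcat (slice (catX \<Gamma>) Y) (fibF \<Gamma>)"

text \<open>
  A choice of pullbacks for the functor \<open>H\<^sup>B\<close>: for \<open>g : X \<rightarrow> I B\<close>, \<open>chosen_pb \<Gamma> B g\<close> is a pair
  consisting of the pullback \<open>P \<rightarrow> B\<close> of \<open>H g\<close> along \<open>\<eta>\<^sub>B\<close> and the other projection \<open>P \<rightarrow> H X\<close>.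
\<close>

definition chosen_pb :: "('o, 'a, 'p, 'b) galois \<Rightarrow> 'o \<Rightarrow> 'b \<Rightarrow> 'a \<times> 'a" where
  "chosen_pb \<Gamma> B g =
     (SOME pq. is_pullback (catC \<Gamma>) (fst pq) (snd pq) (unit \<Gamma> B) (amap (fH \<Gamma>) g))"

definition HB_obj :: "('o, 'a, 'p, 'b) galois \<Rightarrow> 'o \<Rightarrow> 'b \<Rightarrow> 'a" where
  "HB_obj \<Gamma> B g = fst (chosen_pb \<Gamma> B g)"

definition HB_proj :: "('o, 'a, 'p, 'b) galois \<Rightarrow> 'o \<Rightarrow> 'b \<Rightarrow> 'a" where
  "HB_proj \<Gamma> B g = snd (chosen_pb \<Gamma> B g)"

text \<open>On arrows, \<open>H\<^sup>B\<close> is given by the universal property of the pullbacks.\<close>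

definition HB ::
  "('o, 'a, 'p, 'b) galois \<Rightarrow> 'o \<Rightarrow> ('b, 'b \<times> 'b \<times> 'b, 'a, 'a \<times> 'a \<times> 'a) fctr" where
  "HB \<Gamma> B = \<lparr>
     omap = HB_obj \<Gamma> B,
     amap = (\<lambda>(g, h, g').
       (HB_obj \<Gamma> B g,
        (THE k. k \<in> hom (catC \<Gamma>) (src (catC \<Gamma>) (HB_obj \<Gamma> B g)) (src (catC \<Gamma>) (HB_obj \<Gamma> B g')) \<and>
           HB_obj \<Gamma> B g' \<cdot>\<^bsub>catC \<Gamma>\<^esub> k = HB_obj \<Gamma> B g \<and>
           HB_proj \<Gamma> B g' \<cdot>\<^bsub>catC \<Gamma>\<^esub> k = amap (fH \<Gamma>) h \<cdot>\<^bsub>catC \<Gamma>\<^esub> HB_proj \<Gamma> B g),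
        HB_obj \<Gamma> B g'))\<rparr>"

definition admissible :: "('o, 'a, 'p, 'b) galois \<Rightarrow> bool" where
  "admissible \<Gamma> \<longleftrightarrow>
     (\<forall>B \<in> obj (catC \<Gamma>).
        fully_faithful (FibX_over \<Gamma> (omap (fI \<Gamma>) B)) (Fib_over \<Gamma> B) (HB \<Gamma> B))"

definition trivial_extension :: "('o, 'a, 'p, 'b) galois \<Rightarrow> 'a \<Rightarrow> bool" where
  "trivial_extension \<Gamma> f \<longleftrightarrow> f \<in> fibE \<Gamma> \<and>
     is_pullback (catC \<Gamma>) f (unit \<Gamma> (src (catC \<Gamma>) f))
       (unit \<Gamma> (tgt (catC \<Gamma>) f)) (amap (fH \<Gamma>) (amap (fI \<Gamma>) f))"

text \<open>
  Kernel pairs exist in \<open>catC \<Gamma>\<close> and are unique up to isomorphism, so it does not matter which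
  kernel pair is used.
\<close>

definition normal_extension :: "('o, 'a, 'p, 'b) galois \<Rightarrow> 'a \<Rightarrow> bool" where
  "normal_extension \<Gamma> f \<longleftrightarrow> f \<in> fibE \<Gamma> \<and>
     (\<exists>p q. is_kernel_pair (catC \<Gamma>) p q f \<and> trivial_extension \<Gamma> p \<and> trivial_extension \<Gamma> q)"

definition Fib :: "('o, 'a, 'p, 'b) galois \<Rightarrow> ('a, 'a \<times> 'a \<times> 'a \<times> 'a) cat" where
  "Fib \<Gamma> = full_subcat (arrow_cat (catC \<Gamma>)) (fibE \<Gamma>)"

definition Norm :: "('o, 'a, 'p, 'b) galois \<Rightarrow> ('a, 'a \<times> 'a \<times> 'a \<times> 'a) cat" where
  "Norm \<Gamma> = full_subcat (Fib \<Gamma>) {f. normal_extension \<Gamma> f}"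

definition Norm_over :: "('o, 'a, 'p, 'b) galois \<Rightarrow> 'o \<Rightarrow> ('a, 'a \<times> 'a \<times> 'a) cat" where
  "Norm_over \<Gamma> B = full_subcat (Fib_over \<Gamma> B) {f. normal_extension \<Gamma> f}"

end

theory Submission
  imports Defs
begin

text \<open>
  Both claims follow from one construction: every fibration \<open>f : A \<rightarrow> B\<close> has a universal arrow
  \<open>f' u = f\<close> to a normal extension \<open>f'\<close> over the same base \<open>B\<close>, universal even among all commutative
  squares from \<open>f\<close> to normal extensions over arbitrary bases (\<open>normal_reflection_exists\<close>). Squares
  whose bottom is an identity give the reflection over \<open>B\<close>, all squares give the one in the category
  of fibrations.

  For trivial extensions such a universal arrow is explicit: it goes to the pullback \<open>t\<close> of \<open>H I f\<close>
  along \<open>\<eta>\<close> (\<open>trivial_reflection_exists\<close>). Admissibility forces the counit of the adjunction between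
  slices to be invertible, and this makes \<open>t\<close> trivial (\<open>trivial_of_pullback\<close>) and its universal
  property hold with uniqueness. The same criterion shows that trivial extensions are stable under
  pullback, hence normal.

  A fibration \<open>f\<close> is the coequaliser, in the category of arrows, of its pullbacks along itself:
  writing \<open>p : R \<rightarrow> A\<close> for the first kernel pair projection and \<open>p' : S \<rightarrow> R\<close> for the projection
  \<open>(a, b, c) \<mapsto> (a, b)\<close> from triples with equal image, there is a reflexive graph from \<open>p'\<close> to \<open>p\<close> over
  the kernel pair of \<open>f\<close>, with coequaliser \<open>f\<close>. Apply the trivial reflection to this graph and take the
  coequaliser \<open>f'\<close> of the result among fibrations. It lies over \<open>B\<close>, and it is normal by the closure
  hypothesis.

  For universality one must compare the original graph with the reflected one in terms of maps to a
  normal extension \<open>n\<close>. As \<open>n\<close> need not be trivial, the universal property of trivial reflections does not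
  apply directly. But the maps in question lie over a base map that factors through \<open>n\<close> itself, and
  \<open>n\<close> becomes trivial when it is pulled back along \<open>n\<close>. Hence they do extend uniquely to the trivial
  reflection (\<open>normal_lift\<close>, \<open>normal_unique\<close>).
\<close>

section \<open>Computing in a category\<close>

context category
begin

lemma arr_cmp [simp]: "\<lbrakk>f \<in> arr C; g \<in> arr C; tgt C f = src C g\<rbrakk> \<Longrightarrow> g \<cdot> f \<in> arr C"
  and src_cmp [simp]: "\<lbrakk>f \<in> arr C; g \<in> arr C; tgt C f = src C g\<rbrakk> \<Longrightarrow> src C (g \<cdot> f) = src C f"
  and tgt_cmp [simp]: "\<lbrakk>f \<in> arr C; g \<in> arr C; tgt C f = src C g\<rbrakk> \<Longrightarrow> tgt C (g \<cdot> f) = tgt C g"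
  using cmp_hom[of f "src C f" "tgt C f" g "tgt C g"] by (simp_all add: hom_def)

lemma arr_ide [simp]: "a \<in> obj C \<Longrightarrow> ide C a \<in> arr C"
  and src_ide [simp]: "a \<in> obj C \<Longrightarrow> src C (ide C a) = a"
  and tgt_ide [simp]: "a \<in> obj C \<Longrightarrow> tgt C (ide C a) = a"
  using ide_hom[of a] by (simp_all add: hom_def)

lemma cmp_ide [simp]:
  "\<lbrakk>f \<in> arr C; src C f = a\<rbrakk> \<Longrightarrow> f \<cdot> ide C a = f"
  "\<lbrakk>f \<in> arr C; tgt C f = a\<rbrakk> \<Longrightarrow> ide C a \<cdot> f = f"
  using cmp_ide_right[of f] cmp_ide_left[of f] by (simp_all add: hom_def)

lemma cmp_assoc_arr [simp]:
  "\<lbrakk>f \<in> arr C; g \<in> arr C; h \<in> arr C; tgt C f = src C g; tgt C g = src C h\<rbrakk>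
    \<Longrightarrow> (h \<cdot> g) \<cdot> f = h \<cdot> (g \<cdot> f)"
  using cmp_assoc[of f "src C f" "tgt C f" g "tgt C g" h "tgt C h"] by (simp add: hom_def)

declare src_obj [simp] tgt_obj [simp]

text \<open>
  Composites are normalised to the right, so an equation \<open>g f = k\<close> also has to be available as a
  rewrite rule for the subterm \<open>g (f x)\<close> of a longer composite.
\<close>

lemma extend:
  "\<lbrakk>g \<cdot> f = k; f \<in> arr C; g \<in> arr C; tgt C f = src C g; x \<in> arr C; tgt C x = src C f\<rbrakk>
    \<Longrightarrow> g \<cdot> (f \<cdot> x) = k \<cdot> x"
  by (metis cmp_assoc_arr)

lemma pullback_arr:
  assumes "is_pullback C p q f g"
  shows "p \<in> arr C" "q \<in> arr C" "f \<in> arr C" "g \<in> arr C"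
    "src C q = src C p" "tgt C p = src C f" "tgt C q = src C g" "tgt C g = tgt C f"
    "f \<cdot> p = g \<cdot> q"
  using assms by (simp_all add: is_pullback_def)

lemma pullback_lift:
  assumes "is_pullback C p q f g" "u \<in> hom C a (src C f)" "v \<in> hom C a (src C g)"
    "f \<cdot> u = g \<cdot> v"
  obtains w where "w \<in> arr C" "src C w = a" "tgt C w = src C p" "p \<cdot> w = u" "q \<cdot> w = v"
proof -
  have "a \<in> obj C" using assms(2) src_obj by (auto simp: hom_def)
  then have "\<exists>!w. w \<in> hom C a (src C p) \<and> p \<cdot> w = u \<and> q \<cdot> w = v"
    using assms unfolding is_pullback_def by blast
  then show ?thesis using that by (auto simp: hom_def)
qed

lemma pullback_jointly_monic:
  assumes pb: "is_pullback C p q f g"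
    and u: "u \<in> arr C" "tgt C u = src C p" and v: "v \<in> arr C" "tgt C v = src C p" "src C v = src C u"
    and eq: "p \<cdot> u = p \<cdot> v" "q \<cdot> u = q \<cdot> v"
  shows "u = v"
proof -
  note a = pullback_arr[OF pb]
  have "\<exists>!w. w \<in> hom C (src C u) (src C p) \<and> p \<cdot> w = p \<cdot> u \<and> q \<cdot> w = q \<cdot> u"
  proof -
    have "f \<cdot> (p \<cdot> u) = g \<cdot> (q \<cdot> u)" using a u by (simp add: a(9)[THEN extend])
    then show ?thesis using pb a u unfolding is_pullback_def
      by (auto simp: hom_def)
  qed
  then show ?thesis using u v eq by (auto simp: hom_def)
qed

lemma pullbackI:
  assumes "p \<in> arr C" "q \<in> arr C" "f \<in> arr C" "g \<in> arr C"
    "src C q = src C p" "tgt C p = src C f" "tgt C q = src C g" "tgt C g = tgt C f"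
    "f \<cdot> p = g \<cdot> q"
    and ex: "\<And>u v. \<lbrakk>u \<in> arr C; v \<in> arr C; src C v = src C u; tgt C u = src C f; tgt C v = src C g;
       f \<cdot> u = g \<cdot> v\<rbrakk> \<Longrightarrow> \<exists>w \<in> hom C (src C u) (src C p). p \<cdot> w = u \<and> q \<cdot> w = v"
    and uniq: "\<And>u v. \<lbrakk>u \<in> arr C; v \<in> arr C; src C v = src C u; tgt C u = src C p; tgt C v = src C p;
       p \<cdot> u = p \<cdot> v; q \<cdot> u = q \<cdot> v\<rbrakk> \<Longrightarrow> u = v"
  shows "is_pullback C p q f g"
  unfolding is_pullback_def
proof (intro conjI ballI impI)
  fix a u v
  assume h: "a \<in> obj C" "u \<in> hom C a (src C f)" "v \<in> hom C a (src C g)" "f \<cdot> u = g \<cdot> v"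
  then obtain w where w: "w \<in> hom C a (src C p)" "p \<cdot> w = u" "q \<cdot> w = v"
    using ex[of u v] by (auto simp: hom_def)
  show "\<exists>!w. w \<in> hom C a (src C p) \<and> p \<cdot> w = u \<and> q \<cdot> w = v"
  proof (rule ex1I[of _ w])
    fix w' assume "w' \<in> hom C a (src C p) \<and> p \<cdot> w' = u \<and> q \<cdot> w' = v"
    then show "w' = w" using w uniq[of w' w] by (auto simp: hom_def)
  qed (use w in blast)
qed (use assms in simp_all)

lemma pullback_sym: "is_pullback C p q f g \<Longrightarrow> is_pullback C q p g f"
proof (rule pullbackI)
  assume pb: "is_pullback C p q f g"
  note a = pullback_arr[OF pb]
  show "\<exists>w \<in> hom C (src C u) (src C q). q \<cdot> w = u \<and> p \<cdot> w = v"
    if "u \<in> arr C" "v \<in> arr C" "src C v = src C u" "tgt C u = src C g" "tgt C v = src C f"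
      "g \<cdot> u = f \<cdot> v" for u v
    by (rule pullback_lift[OF pb, of v "src C u" u]) (use that a in \<open>auto simp: hom_def\<close>)
  show "u = v" if "u \<in> arr C" "v \<in> arr C" "src C v = src C u" "tgt C u = src C q"
    "tgt C v = src C q" "q \<cdot> u = q \<cdot> v" "p \<cdot> u = p \<cdot> v" for u v
    by (rule pullback_jointly_monic[OF pb]) (use that a in auto)
qed (use pullback_arr[of p q f g] in auto)

lemma coequaliser_factor:
  assumes "is_coequaliser C x y q" "u \<in> arr C" "src C u = tgt C x" "u \<cdot> x = u \<cdot> y"
  obtains w where "w \<in> arr C" "src C w = tgt C q" "tgt C w = tgt C u" "w \<cdot> q = u"
proof -
  have "\<exists>!w. w \<in> hom C (tgt C q) (tgt C u) \<and> w \<cdot> q = u"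
    using assms unfolding is_coequaliser_def by (auto simp: hom_def)
  then show ?thesis using that by (auto simp: hom_def)
qed

lemma coequaliser_epi:
  assumes q: "is_coequaliser C x y q"
    and u: "u \<in> arr C" "src C u = tgt C q" and v: "v \<in> arr C" "src C v = tgt C q" "tgt C v = tgt C u"
    and eq: "u \<cdot> q = v \<cdot> q"
  shows "u = v"
proof -
  have a: "x \<in> arr C" "y \<in> arr C" "q \<in> arr C" "src C x = src C y" "tgt C x = tgt C y"
    "src C q = tgt C x" and e: "q \<cdot> x = q \<cdot> y"
    using q by (simp_all add: is_coequaliser_def)
  have "(u \<cdot> q) \<cdot> x = (u \<cdot> q) \<cdot> y" using a e u by simp
  then have "\<exists>!w. w \<in> hom C (tgt C q) (tgt C u) \<and> w \<cdot> q = u \<cdot> q"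
    using q u a unfolding is_coequaliser_def by (auto simp: hom_def)
  then show ?thesis using u v eq by (auto simp: hom_def)
qed

lemma coequaliserI:
  assumes "x \<in> arr C" "y \<in> arr C" "q \<in> arr C" "src C x = src C y" "tgt C x = tgt C y"
    "src C q = tgt C x" "q \<cdot> x = q \<cdot> y"
    and ex: "\<And>u. \<lbrakk>u \<in> arr C; src C u = tgt C x; u \<cdot> x = u \<cdot> y\<rbrakk>
      \<Longrightarrow> \<exists>w \<in> hom C (tgt C q) (tgt C u). w \<cdot> q = u"
    and uniq: "\<And>u v. \<lbrakk>u \<in> arr C; v \<in> arr C; src C u = tgt C q; src C v = tgt C q;
       tgt C v = tgt C u; u \<cdot> q = v \<cdot> q\<rbrakk> \<Longrightarrow> u = v"
  shows "is_coequaliser C x y q"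
  unfolding is_coequaliser_def
proof (intro conjI ballI impI)
  fix c u
  assume h: "c \<in> obj C" "u \<in> hom C (tgt C x) c" "u \<cdot> x = u \<cdot> y"
  then obtain w where w: "w \<in> hom C (tgt C q) c" "w \<cdot> q = u"
    using ex[of u] by (auto simp: hom_def)
  show "\<exists>!w. w \<in> hom C (tgt C q) c \<and> w \<cdot> q = u"
  proof (rule ex1I[of _ w])
    fix w' assume "w' \<in> hom C (tgt C q) c \<and> w' \<cdot> q = u"
    then show "w' = w" using w uniq[of w' w] by (auto simp: hom_def)
  qed (use w in blast)
qed (use assms in simp_all)

text \<open>
  The pair of which \<open>f\<close> is the coequaliser factors through the kernel pair, so an arrow that
  coequalises the kernel pair also coequalises that pair.
\<close>

lemma regular_epi_is_coequaliser_of_kernel_pair: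
  assumes f: "f \<in> regular_epis C" and k: "is_kernel_pair C p q f"
  shows "is_coequaliser C p q f"
proof -
  obtain x y where c: "is_coequaliser C x y f" using f by (auto simp: regular_epis_def)
  have a: "x \<in> arr C" "y \<in> arr C" "f \<in> arr C" "src C x = src C y" "tgt C x = tgt C y"
    "src C f = tgt C x" and e: "f \<cdot> x = f \<cdot> y"
    using c by (simp_all add: is_coequaliser_def)
  have pb: "is_pullback C p q f f" using k by (simp add: is_kernel_pair_def)
  note b = pullback_arr[OF pb]
  obtain w where w: "w \<in> arr C" "src C w = src C x" "tgt C w = src C p" "p \<cdot> w = x" "q \<cdot> w = y"
    by (rule pullback_lift[OF pb, of x "src C x" y]) (use a e in \<open>auto simp: hom_def\<close>)
  show ?thesis
  proof (rule coequaliserI)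
    fix u assume u: "u \<in> arr C" "src C u = tgt C p" "u \<cdot> p = u \<cdot> q"
    have "(u \<cdot> p) \<cdot> w = (u \<cdot> q) \<cdot> w" using u by simp
    moreover have "(u \<cdot> p) \<cdot> w = u \<cdot> x" "(u \<cdot> q) \<cdot> w = u \<cdot> y"
      using u(1,2) b w by simp_all
    ultimately have "u \<cdot> x = u \<cdot> y" by simp
    then obtain z where "z \<in> arr C" "src C z = tgt C f" "tgt C z = tgt C u" "z \<cdot> f = u"
      using coequaliser_factor[OF c, of u] u a b by auto
    then show "\<exists>z \<in> hom C (tgt C f) (tgt C u). z \<cdot> f = u" by (auto simp: hom_def)
  next
    fix u v assume h: "u \<in> arr C" "v \<in> arr C" "src C u = tgt C f" "src C v = tgt C f"
       "tgt C v = tgt C u" "u \<cdot> f = v \<cdot> f"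
    show "u = v" by (rule coequaliser_epi[OF c]) (use h in simp_all)
  qed (use b in auto)
qed

text \<open>
  If \<open>g e\<close> is the coequaliser of \<open>(x, y)\<close>, then \<open>g\<close> is the coequaliser of \<open>(e x, e y)\<close>: an arrow
  \<open>u\<close> that coequalises the latter pair satisfies \<open>u e = w g e\<close> for some \<open>w\<close>, and \<open>e\<close> can be cancelled.
\<close>

lemma regular_epi_cancel:
  assumes g: "g \<in> arr C" and e: "is_coequaliser C x' y' e" "tgt C e = src C g"
    and ge: "g \<cdot> e \<in> regular_epis C"
  shows "g \<in> regular_epis C"
proof -
  have ea: "e \<in> arr C" using e by (simp add: is_coequaliser_def)
  obtain x y where c: "is_coequaliser C x y (g \<cdot> e)" using ge by (auto simp: regular_epis_def)
  have a: "x \<in> arr C" "y \<in> arr C" "src C x = src C y" "tgt C x = tgt C y"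
    "src C e = tgt C x" and eq: "g \<cdot> (e \<cdot> x) = g \<cdot> (e \<cdot> y)"
    using c ea g e by (auto simp: is_coequaliser_def)
  have "is_coequaliser C (e \<cdot> x) (e \<cdot> y) g"
  proof (rule coequaliserI)
    fix u assume u: "u \<in> arr C" "src C u = tgt C (e \<cdot> x)" "u \<cdot> (e \<cdot> x) = u \<cdot> (e \<cdot> y)"
    obtain w where w: "w \<in> arr C" "src C w = tgt C g" "tgt C w = tgt C u" "w \<cdot> (g \<cdot> e) = u \<cdot> e"
      by (rule coequaliser_factor[OF c, of "u \<cdot> e"]) (use u a ea g e in auto)
    have "w \<cdot> g = u"
      by (rule coequaliser_epi[OF e(1)]) (use w u a ea g e in auto)
    then show "\<exists>w \<in> hom C (tgt C g) (tgt C u). w \<cdot> g = u" using w by (auto simp: hom_def)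
  next
    fix u v assume h: "u \<in> arr C" "v \<in> arr C" "src C u = tgt C g" "src C v = tgt C g"
       "tgt C v = tgt C u" "u \<cdot> g = v \<cdot> g"
    have "u \<cdot> (g \<cdot> e) = v \<cdot> (g \<cdot> e)" using h(1-5) g ea e(2) by (simp add: extend[OF h(6)])
    then show "u = v" by (rule coequaliser_epi[OF c, rotated -1]) (use h(1-5) g ea e(2) in simp_all)
  qed (use a ea g e eq in auto)
  then show ?thesis by (auto simp: regular_epis_def)
qed

end

section \<open>Slices, arrow categories and reflections\<close>

lemma slice_simps [simp]:
  "f \<in> obj (slice C b) \<longleftrightarrow> f \<in> arr C \<and> tgt C f = b"
  "(f, h, g) \<in> arr (slice C b) \<longleftrightarrow> f \<in> arr C \<and> tgt C f = b \<and> g \<in> arr C \<and> tgt C g = b \<and>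
     h \<in> arr C \<and> src C h = src C f \<and> tgt C h = src C g \<and> g \<cdot>\<^bsub>C\<^esub> h = f"
  "src (slice C b) (f, h, g) = f"
  "tgt (slice C b) (f, h, g) = g"
  "ide (slice C b) f = (f, ide C (src C f), f)"
  "cmp (slice C b) (f', h', g') (f, h, g) = (f, h' \<cdot>\<^bsub>C\<^esub> h, g')"
  by (simp_all add: slice_def hom_def)

lemma (in category) category_slice: "category (slice C b)"
proof
  fix F assume "F \<in> arr (slice C b)" 
  then show "src (slice C b) F \<in> obj (slice C b)" "tgt (slice C b) F \<in> obj (slice C b)"
    by (cases F; simp)+
next
  fix a assume "a \<in> obj (slice C b)"
  then show "ide (slice C b) a \<in> hom (slice C b) a a" by (simp add: hom_def)
next
  fix F G a b' c
  assume "F \<in> hom (slice C b) a b'" "G \<in> hom (slice C b) b' c"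
  moreover have "f'' \<cdot> (k \<cdot> h) = f"
    if "f' \<cdot> h = f" "f'' \<cdot> k = f'" "h \<in> arr C" "k \<in> arr C" "f'' \<in> arr C"
      "tgt C h = src C k" "tgt C k = src C f''" for f f' f'' h k
    using that(3-) by (simp add: that(1) extend[OF that(2)])
  ultimately show "G \<cdot>\<^bsub>slice C b\<^esub> F \<in> hom (slice C b) a c"
    by (cases F; cases G) (clarsimp simp: hom_def)
next
  fix F a b'
  assume "F \<in> hom (slice C b) a b'" 
  then show "F \<cdot>\<^bsub>slice C b\<^esub> ide (slice C b) a = F" "ide (slice C b) b' \<cdot>\<^bsub>slice C b\<^esub> F = F"
    by (cases F; simp add: hom_def)+
next
  fix F G H a b' c d
  assume "F \<in> hom (slice C b) a b'" "G \<in> hom (slice C b) b' c" "H \<in> hom (slice C b) c d"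
  then show "(H \<cdot>\<^bsub>slice C b\<^esub> G) \<cdot>\<^bsub>slice C b\<^esub> F = H \<cdot>\<^bsub>slice C b\<^esub> (G \<cdot>\<^bsub>slice C b\<^esub> F)"
    by (cases F; cases G; cases H) (simp add: hom_def)
qed

lemma arrow_cat_simps [simp]:
  "obj (arrow_cat C) = arr C"
  "(f, h, k, g) \<in> arr (arrow_cat C) \<longleftrightarrow> f \<in> arr C \<and> g \<in> arr C \<and>
     h \<in> arr C \<and> src C h = src C f \<and> tgt C h = src C g \<and>
     k \<in> arr C \<and> src C k = tgt C f \<and> tgt C k = tgt C g \<and> k \<cdot>\<^bsub>C\<^esub> f = g \<cdot>\<^bsub>C\<^esub> h"
  "src (arrow_cat C) (f, h, k, g) = f"
  "tgt (arrow_cat C) (f, h, k, g) = g"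
  "ide (arrow_cat C) f = (f, ide C (src C f), ide C (tgt C f), f)"
  "cmp (arrow_cat C) (f', h', k', g') (f, h, k, g) = (f, h' \<cdot>\<^bsub>C\<^esub> h, k' \<cdot>\<^bsub>C\<^esub> k, g')"
  by (simp_all add: arrow_cat_def hom_def)

lemma (in category) category_arrow_cat: "category (arrow_cat C)"
proof
  fix F assume "F \<in> arr (arrow_cat C)" 
  then show "src (arrow_cat C) F \<in> obj (arrow_cat C)" "tgt (arrow_cat C) F \<in> obj (arrow_cat C)"
    by (cases F; simp)+
next
  fix a assume "a \<in> obj (arrow_cat C)"
  then show "ide (arrow_cat C) a \<in> hom (arrow_cat C) a a" by (simp add: hom_def)
next
  fix F G a b c
  assume "F \<in> hom (arrow_cat C) a b" "G \<in> hom (arrow_cat C) b c"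
  then obtain h k h' k' where F: "F = (a, h, k, b)" "G = (b, h', k', c)"
    and a: "a \<in> arr C" "b \<in> arr C" "c \<in> arr C"
      "h \<in> arr C" "src C h = src C a" "tgt C h = src C b"
      "k \<in> arr C" "src C k = tgt C a" "tgt C k = tgt C b"
      "h' \<in> arr C" "src C h' = src C b" "tgt C h' = src C c"
      "k' \<in> arr C" "src C k' = tgt C b" "tgt C k' = tgt C c"
    and e: "k \<cdot> a = b \<cdot> h" "k' \<cdot> b = c \<cdot> h'"
    by (cases F; cases G) (simp add: hom_def)
  have "(k' \<cdot> k) \<cdot> a = c \<cdot> (h' \<cdot> h)" using a by (simp add: e e[THEN extend])
  then show "G \<cdot>\<^bsub>arrow_cat C\<^esub> F \<in> hom (arrow_cat C) a c"
    using a unfolding F by (simp add: hom_def)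
next
  fix F a b
  assume "F \<in> hom (arrow_cat C) a b" 
  then show "F \<cdot>\<^bsub>arrow_cat C\<^esub> ide (arrow_cat C) a = F" "ide (arrow_cat C) b \<cdot>\<^bsub>arrow_cat C\<^esub> F = F"
    by (cases F; auto simp add: hom_def)+
next
  fix F G H a b c d
  assume "F \<in> hom (arrow_cat C) a b" "G \<in> hom (arrow_cat C) b c" "H \<in> hom (arrow_cat C) c d"
  then show "(H \<cdot>\<^bsub>arrow_cat C\<^esub> G) \<cdot>\<^bsub>arrow_cat C\<^esub> F = H \<cdot>\<^bsub>arrow_cat C\<^esub> (G \<cdot>\<^bsub>arrow_cat C\<^esub> F)"
    by (cases F; cases G; cases H) (simp add: hom_def)
qed

lemma full_subcat_simps [simp]:
  "a \<in> obj (full_subcat C S) \<longleftrightarrow> a \<in> obj C \<and> a \<in> S"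
  "f \<in> arr (full_subcat C S) \<longleftrightarrow> f \<in> arr C \<and> src C f \<in> S \<and> tgt C f \<in> S"
  "src (full_subcat C S) = src C"
  "tgt (full_subcat C S) = tgt C"
  "ide (full_subcat C S) = ide C"
  "cmp (full_subcat C S) = cmp C"
  by (simp_all add: full_subcat_def)

lemma (in category) category_full_subcat: "category (full_subcat C S)"
  by unfold_locales (simp_all add: hom_def)

text \<open>
  An inclusion has a left adjoint as soon as every object has a universal arrow into the
  subcategory.
\<close>

lemma (in category) reflective_of_universal_arrows:
  assumes univ: "\<And>a. a \<in> obj C \<Longrightarrow> \<exists>a' \<in> obj C \<inter> S. \<exists>u \<in> hom C a a'.
    \<forall>b \<in> obj C \<inter> S. \<forall>f \<in> hom C a b. \<exists>!g. g \<in> hom C a' b \<and> g \<cdot> u = f"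
  shows "reflective_subcategory (full_subcat C S) C"
proof -
  let ?D = "full_subcat C S"
  interpret D: category ?D by (rule category_full_subcat)
  define Q where "Q a a' u \<longleftrightarrow> a' \<in> obj C \<inter> S \<and> u \<in> hom C a a' \<and>
    (\<forall>b \<in> obj C \<inter> S. \<forall>f \<in> hom C a b. \<exists>!g. g \<in> hom C a' b \<and> g \<cdot> u = f)" for a a' u
  define R where "R a = (SOME a'. \<exists>u. Q a a' u)" for a
  define u where "u a = (SOME u. Q a (R a) u)" for a
  have "\<exists>a'. \<exists>u. Q a a' u" if "a \<in> obj C" for a
    using univ[OF that] unfolding Q_def by (simp only: Bex_def) blast
  then have "\<exists>u. Q a (R a) u" if "a \<in> obj C" for a
    unfolding R_def using that by (rule_tac someI_ex) simp
  then have Q: "Q a (R a) (u a)" if "a \<in> obj C" for a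
    unfolding u_def using that by (rule_tac someI_ex) simp
  have R: "R a \<in> obj C \<and> R a \<in> S" if "a \<in> obj C" for a
    using Q[OF that] by (simp add: Q_def)
  have u: "u a \<in> arr C \<and> src C (u a) = a \<and> tgt C (u a) = R a" if "a \<in> obj C" for a
    using Q[OF that] by (simp add: Q_def hom_def)
  have ex: "\<exists>!g. g \<in> hom C (R a) b \<and> g \<cdot> u a = f"
    if "a \<in> obj C" "b \<in> obj C" "b \<in> S" "f \<in> hom C a b" for a b f
    using Q[OF that(1)] that(2-) by (simp add: Q_def)
  define ext where "ext f = (THE g. g \<in> hom C (R (src C f)) (tgt C f) \<and> g \<cdot> u (src C f) = f)" for f
  have ext: "ext f \<in> arr C" "src C (ext f) = R (src C f)" "tgt C (ext f) = tgt C f"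
    "ext f \<cdot> u (src C f) = f" if "f \<in> arr C" "tgt C f \<in> S" for f
    using theI'[OF ex[of "src C f" "tgt C f" f]] that by (simp_all add: ext_def hom_def)
  have uniq: "g = h" if "a \<in> obj C" "g \<in> arr C" "h \<in> arr C" "src C g = R a" "src C h = R a"
    "tgt C h = tgt C g" "tgt C g \<in> S" "g \<cdot> u a = h \<cdot> u a" for a g h
    using ex[of a "tgt C g" "g \<cdot> u a"] that u[of a] R[of a] by (auto simp: hom_def)
  define L where "L = \<lparr>omap = R, amap = (\<lambda>f. ext (u (tgt C f) \<cdot> f))\<rparr>"
  define \<epsilon> where "\<epsilon> b = ext (ide C b)" for b
  have oL: "omap L a = R a" for a by (simp add: L_def)
  have L: "amap L f \<in> arr C" "src C (amap L f) = R (src C f)" "tgt C (amap L f) = R (tgt C f)"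
    "amap L f \<cdot> u (src C f) = u (tgt C f) \<cdot> f" if "f \<in> arr C" for f
    using ext[of "u (tgt C f) \<cdot> f"] that u[of "tgt C f"] R[of "tgt C f"] by (simp_all add: L_def)
  have e: "\<epsilon> b \<in> arr C" "src C (\<epsilon> b) = R b" "tgt C (\<epsilon> b) = b" "\<epsilon> b \<cdot> u b = ide C b"
    if "b \<in> obj C" "b \<in> S" for b
    using ext[of "ide C b"] that by (simp_all add: \<epsilon>_def)
  have fL: "is_functor C ?D L"
    unfolding is_functor_def
  proof (intro conjI ballI impI)
    fix a assume a: "a \<in> obj C"
    show "amap L (ide C a) = ide ?D (omap L a)"
      by (rule uniq[of a]) (use a L[of "ide C a"] R[of a] u[of a] in \<open>simp_all add: oL\<close>)
  next
    fix f g assume h: "f \<in> arr C" "g \<in> arr C" "tgt C f = src C g"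
    have "amap L (g \<cdot> f) \<cdot> u (src C f) = (amap L g \<cdot> amap L f) \<cdot> u (src C f)"
      using h L(1,2,3) u L(4)[of "g \<cdot> f"] by (simp add: L(4) L(4)[of g, THEN extend])
    then have "amap L (g \<cdot> f) = amap L g \<cdot> amap L f"
      by (rule uniq[of "src C f", rotated -1]) (use h L(1,2,3) R in simp_all)
    then show "amap L (g \<cdot> f) = amap L g \<cdot>\<^bsub>?D\<^esub> amap L f" by simp
  qed (use category_axioms D.category_axioms R L in \<open>simp_all add: oL hom_def\<close>)
  have fI: "is_functor ?D C id_fctr"
    unfolding is_functor_def using category_axioms D.category_axioms
    by (simp add: id_fctr_def hom_def)
  have unit: "nat_trans C C id_fctr (comp_fctr id_fctr L) u"
    using fL category_axioms L u R
    by (simp add: nat_trans_def is_functor_def id_fctr_def comp_fctr_def hom_def oL)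
  have counit: "nat_trans ?D ?D (comp_fctr L id_fctr) id_fctr \<epsilon>"
  proof -
    have "\<epsilon> (tgt C f) \<cdot> amap L f = f \<cdot> \<epsilon> (src C f)" if "f \<in> arr C" "src C f \<in> S" "tgt C f \<in> S" for f
    proof (rule uniq[of "src C f"])
      show "(\<epsilon> (tgt C f) \<cdot> amap L f) \<cdot> u (src C f) = (f \<cdot> \<epsilon> (src C f)) \<cdot> u (src C f)"
        using that L[of f] e[of "src C f"] e[of "tgt C f"] u by (simp add: e(4)[THEN extend])
    qed (use that L[of f] e[of "src C f"] e[of "tgt C f"] in simp_all)
    then show ?thesis
      using fL D.category_axioms L e R
      by (simp add: nat_trans_def is_functor_def id_fctr_def comp_fctr_def hom_def oL)
  qed
  have t1: "\<epsilon> (R a) \<cdot> amap L (u a) = ide C (R a)" if "a \<in> obj C" for a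
  proof (rule uniq[of a])
    show "(\<epsilon> (R a) \<cdot> amap L (u a)) \<cdot> u a = ide C (R a) \<cdot> u a"
      using that L[of "u a"] e[of "R a"] u[of a] u[of "R a"] R[of a] by (simp add: e(4)[THEN extend])
  qed (use that L[of "u a"] e[of "R a"] u[of a] R[of a] in simp_all)
  have "adjunction C ?D L id_fctr u \<epsilon>"
    unfolding adjunction_def using fL fI unit counit t1 e by (simp add: oL id_fctr_def)
  moreover have "is_subcategory ?D C"
    unfolding is_subcategory_def using category_axioms D.category_axioms by auto
  ultimately show ?thesis unfolding reflective_subcategory_def by blast
qed

section \<open>Adjunctions\<close>

locale adjoint_pair =
  fixes C :: "('o, 'a) cat" (structure) and X :: "('p, 'b) cat"
    and I :: "('o, 'a, 'p, 'b) fctr" and H :: "('p, 'b, 'o, 'a) fctr"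
    and \<eta> :: "'o \<Rightarrow> 'a" and \<epsilon> :: "'p \<Rightarrow> 'b"
  assumes adj: "adjunction C X I H \<eta> \<epsilon>"
begin

abbreviation I\<^sub>0 where "I\<^sub>0 \<equiv> omap I"
abbreviation I\<^sub>1 where "I\<^sub>1 \<equiv> amap I"
abbreviation H\<^sub>0 where "H\<^sub>0 \<equiv> omap H"
abbreviation H\<^sub>1 where "H\<^sub>1 \<equiv> amap H"

lemma functors: "is_functor C X I" "is_functor X C H"
  using adj by (simp_all add: adjunction_def)

sublocale C: category C using functors(1) by (simp add: is_functor_def)
sublocale X: category X using functors(1) by (simp add: is_functor_def)

lemma I_simps [simp]:
  "a \<in> obj C \<Longrightarrow> I\<^sub>0 a \<in> obj X"
  "f \<in> arr C \<Longrightarrow> I\<^sub>1 f \<in> arr X"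
  "f \<in> arr C \<Longrightarrow> src X (I\<^sub>1 f) = I\<^sub>0 (src C f)"
  "f \<in> arr C \<Longrightarrow> tgt X (I\<^sub>1 f) = I\<^sub>0 (tgt C f)"
  "a \<in> obj C \<Longrightarrow> I\<^sub>1 (ide C a) = ide X (I\<^sub>0 a)"
  "\<lbrakk>f \<in> arr C; g \<in> arr C; tgt C f = src C g\<rbrakk> \<Longrightarrow> I\<^sub>1 (g \<cdot> f) = I\<^sub>1 g \<cdot>\<^bsub>X\<^esub> I\<^sub>1 f"
  using functors(1) by (simp_all add: is_functor_def hom_def)

lemma H_simps [simp]:
  "x \<in> obj X \<Longrightarrow> H\<^sub>0 x \<in> obj C"
  "f \<in> arr X \<Longrightarrow> H\<^sub>1 f \<in> arr C"
  "f \<in> arr X \<Longrightarrow> src C (H\<^sub>1 f) = H\<^sub>0 (src X f)"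
  "f \<in> arr X \<Longrightarrow> tgt C (H\<^sub>1 f) = H\<^sub>0 (tgt X f)"
  "x \<in> obj X \<Longrightarrow> H\<^sub>1 (ide X x) = ide C (H\<^sub>0 x)"
  "\<lbrakk>f \<in> arr X; g \<in> arr X; tgt X f = src X g\<rbrakk> \<Longrightarrow> H\<^sub>1 (g \<cdot>\<^bsub>X\<^esub> f) = H\<^sub>1 g \<cdot> H\<^sub>1 f"
  using functors(2) by (simp_all add: is_functor_def hom_def)

lemma unit_simps [simp]:
  "a \<in> obj C \<Longrightarrow> \<eta> a \<in> arr C"
  "a \<in> obj C \<Longrightarrow> src C (\<eta> a) = a"
  "a \<in> obj C \<Longrightarrow> tgt C (\<eta> a) = H\<^sub>0 (I\<^sub>0 a)"
  using adj by (simp_all add: adjunction_def nat_trans_def hom_def id_fctr_def comp_fctr_def)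

lemma counit_simps [simp]:
  "x \<in> obj X \<Longrightarrow> \<epsilon> x \<in> arr X"
  "x \<in> obj X \<Longrightarrow> src X (\<epsilon> x) = I\<^sub>0 (H\<^sub>0 x)"
  "x \<in> obj X \<Longrightarrow> tgt X (\<epsilon> x) = x"
  using adj by (simp_all add: adjunction_def nat_trans_def hom_def id_fctr_def comp_fctr_def)

lemma unit_nat: "\<lbrakk>f \<in> arr C; src C f = a; tgt C f = b\<rbrakk> \<Longrightarrow> \<eta> b \<cdot> f = H\<^sub>1 (I\<^sub>1 f) \<cdot> \<eta> a"
  using adj by (auto simp: adjunction_def nat_trans_def id_fctr_def comp_fctr_def)

lemma counit_nat:
  "\<lbrakk>k \<in> arr X; src X k = x; tgt X k = y\<rbrakk> \<Longrightarrow> \<epsilon> y \<cdot>\<^bsub>X\<^esub> I\<^sub>1 (H\<^sub>1 k) = k \<cdot>\<^bsub>X\<^esub> \<epsilon> x"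
  using adj by (auto simp: adjunction_def nat_trans_def id_fctr_def comp_fctr_def)

lemma triangles:
  "a \<in> obj C \<Longrightarrow> \<epsilon> (I\<^sub>0 a) \<cdot>\<^bsub>X\<^esub> I\<^sub>1 (\<eta> a) = ide X (I\<^sub>0 a)"
  "x \<in> obj X \<Longrightarrow> H\<^sub>1 (\<epsilon> x) \<cdot> \<eta> (H\<^sub>0 x) = ide C (H\<^sub>0 x)"
  using adj by (simp_all add: adjunction_def)

text \<open>
  Together with \<open>transpose\<close>, this is the bijection between arrows \<open>I a \<rightarrow> x\<close> and \<open>a \<rightarrow> H x\<close>.
\<close>

lemma untranspose:
  assumes "k \<in> arr X" "a \<in> obj C" "src X k = I\<^sub>0 a"
  shows "\<epsilon> (tgt X k) \<cdot>\<^bsub>X\<^esub> I\<^sub>1 (H\<^sub>1 k \<cdot> \<eta> a) = k"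
  using assms by (simp add: X.extend[OF counit_nat[of k]] triangles)

lemma transpose:
  assumes "w \<in> arr C" "src C w = a" "tgt C w = H\<^sub>0 x" "x \<in> obj X"
  shows "H\<^sub>1 (\<epsilon> x \<cdot>\<^bsub>X\<^esub> I\<^sub>1 w) \<cdot> \<eta> a = w"
  using assms C.src_obj[of w]
  by (simp add: unit_nat[of w, symmetric] C.extend[OF triangles(2)])

lemma unit_cancel:
  assumes "k \<in> arr X" "l \<in> arr X" "a \<in> obj C" "src X k = I\<^sub>0 a" "src X l = I\<^sub>0 a"
    "tgt X l = tgt X k" "H\<^sub>1 k \<cdot> \<eta> a = H\<^sub>1 l \<cdot> \<eta> a"
  shows "k = l"
  using untranspose[of k a] untranspose[of l a] assms by simp

text \<open>
  Right adjoints preserve limits: a cone over the image of the cospan under \<open>H\<close> with vertex \<open>a\<close>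
  transposes to a cone over the cospan itself with vertex \<open>I a\<close>.
\<close>

lemma H_preserves_pullback:
  assumes pb: "is_pullback X p q f g"
  shows "is_pullback C (H\<^sub>1 p) (H\<^sub>1 q) (H\<^sub>1 f) (H\<^sub>1 g)"
proof -
  note a = X.pullback_arr[OF pb]
  note o = a(1-4)[THEN X.src_obj] a(1-4)[THEN X.tgt_obj]
  show ?thesis
  proof (rule C.pullbackI)
    show "H\<^sub>1 f \<cdot> H\<^sub>1 p = H\<^sub>1 g \<cdot> H\<^sub>1 q"
      using a H_simps(6)[of p f] H_simps(6)[of q g] by simp
  next
    fix u v
    assume h: "u \<in> arr C" "v \<in> arr C" "src C v = src C u" "tgt C u = src C (H\<^sub>1 f)"
      "tgt C v = src C (H\<^sub>1 g)" and e: "H\<^sub>1 f \<cdot> u = H\<^sub>1 g \<cdot> v"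
    let ?u = "\<epsilon> (src X f) \<cdot>\<^bsub>X\<^esub> I\<^sub>1 u" and ?v = "\<epsilon> (src X g) \<cdot>\<^bsub>X\<^esub> I\<^sub>1 v"
    have s: "src C u \<in> obj C" using h by simp
    have "f \<cdot>\<^bsub>X\<^esub> ?u = \<epsilon> (tgt X f) \<cdot>\<^bsub>X\<^esub> I\<^sub>1 (H\<^sub>1 f \<cdot> u)"
      using h a o by (simp add: X.extend[OF counit_nat[of f]])
    also have "\<dots> = g \<cdot>\<^bsub>X\<^esub> ?v" unfolding e
      using h a o by (simp add: X.extend[OF counit_nat[of g]])
    finally obtain w where w: "w \<in> arr X" "src X w = I\<^sub>0 (src C u)" "tgt X w = src X p"
      "p \<cdot>\<^bsub>X\<^esub> w = ?u" "q \<cdot>\<^bsub>X\<^esub> w = ?v"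
      by (rule X.pullback_lift[OF pb, rotated -2]) (use h a o in \<open>simp_all add: hom_def\<close>)
    have "H\<^sub>1 p \<cdot> (H\<^sub>1 w \<cdot> \<eta> (src C u)) = H\<^sub>1 (p \<cdot>\<^bsub>X\<^esub> w) \<cdot> \<eta> (src C u)"
      using w(1-3) a s by simp
    also have "\<dots> = u" unfolding w(4) using h a o by (intro transpose) simp_all
    finally have 1: "H\<^sub>1 p \<cdot> (H\<^sub>1 w \<cdot> \<eta> (src C u)) = u" .
    have "H\<^sub>1 q \<cdot> (H\<^sub>1 w \<cdot> \<eta> (src C u)) = H\<^sub>1 (q \<cdot>\<^bsub>X\<^esub> w) \<cdot> \<eta> (src C u)"
      using w(1-3) a s by simp
    also have "\<dots> = v" unfolding w(5) using h a o by (intro transpose) simp_all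
    finally have 2: "H\<^sub>1 q \<cdot> (H\<^sub>1 w \<cdot> \<eta> (src C u)) = v" .
    show "\<exists>w \<in> hom C (src C u) (src C (H\<^sub>1 p)). H\<^sub>1 p \<cdot> w = u \<and> H\<^sub>1 q \<cdot> w = v"
      by (rule bexI[of _ "H\<^sub>1 w \<cdot> \<eta> (src C u)"]) (use 1 2 w s a in \<open>simp_all add: hom_def\<close>)
  next
    fix u v
    assume h: "u \<in> arr C" "v \<in> arr C" "src C v = src C u" "tgt C u = src C (H\<^sub>1 p)"
      "tgt C v = src C (H\<^sub>1 p)" and e: "H\<^sub>1 p \<cdot> u = H\<^sub>1 p \<cdot> v" "H\<^sub>1 q \<cdot> u = H\<^sub>1 q \<cdot> v"
    let ?t = "\<lambda>w. \<epsilon> (src X p) \<cdot>\<^bsub>X\<^esub> I\<^sub>1 w"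
    have push: "k \<cdot>\<^bsub>X\<^esub> ?t w = \<epsilon> (tgt X k) \<cdot>\<^bsub>X\<^esub> I\<^sub>1 (H\<^sub>1 k \<cdot> w)"
      if "k \<in> arr X" "src X k = src X p" "w \<in> arr C" "tgt C w = H\<^sub>0 (src X p)" for k w
      using that o by (simp add: X.extend[OF counit_nat[of k]])
    have "?t u = ?t v"
    proof (rule X.pullback_jointly_monic[OF pb])
      show "p \<cdot>\<^bsub>X\<^esub> ?t u = p \<cdot>\<^bsub>X\<^esub> ?t v" "q \<cdot>\<^bsub>X\<^esub> ?t u = q \<cdot>\<^bsub>X\<^esub> ?t v"
        using push[of p u] push[of p v] push[of q u] push[of q v] h a o e by simp_all
    qed (use h a o in simp_all)
    then have eq: "H\<^sub>1 (?t u) \<cdot> \<eta> (src C u) = H\<^sub>1 (?t v) \<cdot> \<eta> (src C u)" by (rule arg_cong)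
    have t: "H\<^sub>1 (?t u) \<cdot> \<eta> (src C u) = u" "H\<^sub>1 (?t v) \<cdot> \<eta> (src C u) = v"
      by (rule transpose; use h(1-5) a(1) o(1) in simp)+
    show "u = v" by (rule trans[OF t(1)[symmetric] trans[OF eq t(2)]])
  qed (use a in simp_all)
qed

end

section \<open>Trivial extensions\<close>

locale admissible_galois = adjoint_pair C X I H \<eta> \<epsilon>
  for C :: "('o, 'a) cat" (structure) and X :: "('p, 'b) cat" and I H \<eta> \<epsilon> +
  fixes E :: "'a set" and F :: "'b set"
  assumes gal: "galois_structure \<lparr>catC = C, catX = X, fI = I, fH = H, unit = \<eta>, counit = \<epsilon>,
      fibE = E, fibF = F\<rparr>"
    and adm: "admissible \<lparr>catC = C, catX = X, fI = I, fH = H, unit = \<eta>, counit = \<epsilon>,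
      fibE = E, fibF = F\<rparr>"
begin

abbreviation \<Gamma> where
  "\<Gamma> \<equiv> \<lparr>catC = C, catX = X, fI = I, fH = H, unit = \<eta>, counit = \<epsilon>, fibE = E, fibF = F\<rparr>"

lemma pullbacks: "has_pullbacks C" "has_pullbacks X"
  using gal by (simp_all add: galois_structure_def barr_exact_def regular_category_def
    finitely_complete_def)

lemma fibrations: "fibration_class C E" "fibration_class X F"
  and preserve: "H\<^sub>1 ` F \<subseteq> E" "I\<^sub>1 ` E \<subseteq> F"
  using gal by (simp_all add: galois_structure_def)

lemma pullback_exists:
  assumes "f \<in> arr C" "g \<in> arr C" "tgt C f = tgt C g"
  obtains p q where "is_pullback C p q f g"
  using pullbacks(1)[unfolded has_pullbacks_def] assms by blast

lemma fibE_arr: "f \<in> E \<Longrightarrow> f \<in> arr C"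
  and fibE_pullback: "\<lbrakk>is_pullback C p q f g; g \<in> E\<rbrakk> \<Longrightarrow> p \<in> E"
  and fibE_cmp: "\<lbrakk>f \<in> E; g \<in> E; tgt C f = src C g\<rbrakk> \<Longrightarrow> g \<cdot> f \<in> E"
  using fibrations(1) unfolding fibration_class_def pullback_stable_def by blast+

lemma fibF_arr: "k \<in> F \<Longrightarrow> k \<in> arr X"
  and fibF_pullback: "\<lbrakk>is_pullback X p q k l; l \<in> F\<rbrakk> \<Longrightarrow> p \<in> F"
  using fibrations(2) unfolding fibration_class_def pullback_stable_def by blast+

lemma H_fib: "k \<in> F \<Longrightarrow> H\<^sub>1 k \<in> E"
  and I_fib: "f \<in> E \<Longrightarrow> I\<^sub>1 f \<in> F"
  using preserve by blast+

text \<open>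
  The functor \<open>H\<^sup>B\<close> has a left adjoint, given by \<open>I\<close>, and its counit at \<open>g\<close> is \<open>\<epsilon> I \<pi>\<close>, where \<open>\<pi>\<close>
  is the projection of the pullback to \<open>H Y\<close>, with \<open>Y\<close> the domain of \<open>g\<close>. Since \<open>H\<^sup>B\<close> is full and
  faithful, this counit is invertible: fullness supplies
  the inverse \<open>d\<close> as a preimage of the unit, faithfulness gives one of the two inverse laws, and
  transposition the other.
\<close>

lemma counit_iso_of_chosen_pullback:
  assumes B: "B \<in> obj C" and g: "g \<in> F" "tgt X g = I\<^sub>0 B"
  obtains f \<pi> d where "is_pullback C f \<pi> (\<eta> B) (H\<^sub>1 g)"
    "d \<in> arr X" "src X d = src X g" "tgt X d = I\<^sub>0 (src C f)"
    "(\<epsilon> (src X g) \<cdot>\<^bsub>X\<^esub> I\<^sub>1 \<pi>) \<cdot>\<^bsub>X\<^esub> d = ide X (src X g)"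
    "d \<cdot>\<^bsub>X\<^esub> (\<epsilon> (src X g) \<cdot>\<^bsub>X\<^esub> I\<^sub>1 \<pi>) = ide X (I\<^sub>0 (src C f))"
proof -
  have chosen: "is_pullback C (HB_obj \<Gamma> B k) (HB_proj \<Gamma> B k) (\<eta> B) (H\<^sub>1 k)"
    if k: "k \<in> F" "tgt X k = I\<^sub>0 B" for k
  proof -
    obtain p q where "is_pullback C p q (\<eta> B) (H\<^sub>1 k)"
      by (rule pullback_exists[of "\<eta> B" "H\<^sub>1 k"]) (use k B fibF_arr in simp_all)
    then have "\<exists>pq. is_pullback C (fst pq) (snd pq) (\<eta> B) (H\<^sub>1 k)" by (intro exI[of _ "(p, q)"]) simp
    from someI_ex[OF this] show ?thesis by (simp add: HB_obj_def HB_proj_def chosen_pb_def)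
  qed
  define f where "f = HB_obj \<Gamma> B g"
  define \<pi> where "\<pi> = HB_proj \<Gamma> B g"
  define A where "A = src C f"
  have pb: "is_pullback C f \<pi> (\<eta> B) (H\<^sub>1 g)" using chosen[OF g] by (simp add: f_def \<pi>_def)
  have ga: "g \<in> arr X" "src X g \<in> obj X" using g(1) fibF_arr by auto
  note a = C.pullback_arr[OF pb]
  have f: "f \<in> E" "f \<in> arr C" "src C f = A" "tgt C f = B" "A \<in> obj C"
    using fibE_pullback[OF pb H_fib[OF g(1)]] a B by (simp_all add: A_def)
  have \<pi>: "\<pi> \<in> arr C" "src C \<pi> = A" "tgt C \<pi> = H\<^sub>0 (src X g)" using a ga by (simp_all add: A_def)
  have sq: "H\<^sub>1 g \<cdot> \<pi> = \<eta> B \<cdot> f" using a by simp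
  have g1: "I\<^sub>1 f \<in> F" "tgt X (I\<^sub>1 f) = I\<^sub>0 B" using f I_fib by simp_all
  define f1 where "f1 = HB_obj \<Gamma> B (I\<^sub>1 f)"
  define \<pi>1 where "\<pi>1 = HB_proj \<Gamma> B (I\<^sub>1 f)"
  have pb1: "is_pullback C f1 \<pi>1 (\<eta> B) (H\<^sub>1 (I\<^sub>1 f))" using chosen[OF g1] by (simp add: f1_def \<pi>1_def)
  note a1 = C.pullback_arr[OF pb1]
  have f1: "f1 \<in> E" "tgt C f1 = B"
    using fibE_pullback[OF pb1 H_fib[OF g1(1)]] a1 B by simp_all
  let ?c = "\<epsilon> (src X g) \<cdot>\<^bsub>X\<^esub> I\<^sub>1 \<pi>"
  have c: "?c \<in> arr X" "src X ?c = I\<^sub>0 A" "tgt X ?c = src X g" using ga \<pi> by simp_all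
  have Hc: "H\<^sub>1 ?c \<cdot> \<eta> A = \<pi>" using \<pi> ga by (intro transpose) simp_all
  have gc: "g \<cdot>\<^bsub>X\<^esub> ?c = I\<^sub>1 f"
  proof (rule unit_cancel[of _ _ A])
    have "H\<^sub>1 (g \<cdot>\<^bsub>X\<^esub> ?c) \<cdot> \<eta> A = H\<^sub>1 g \<cdot> (H\<^sub>1 ?c \<cdot> \<eta> A)"
      using H_simps(6)[of ?c g] c ga f by simp
    then show "H\<^sub>1 (g \<cdot>\<^bsub>X\<^esub> ?c) \<cdot> \<eta> A = H\<^sub>1 (I\<^sub>1 f) \<cdot> \<eta> A"
      unfolding Hc sq using unit_nat[of f A B] f by simp
  qed (use c ga f g in simp_all)
  let ?FX = "FibX_over \<Gamma> (I\<^sub>0 B)" and ?FC = "Fib_over \<Gamma> B"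
  have homX: "(k, h, l) \<in> hom ?FX k l"
    if "k \<in> F" "l \<in> F" "tgt X k = I\<^sub>0 B" "tgt X l = I\<^sub>0 B" "h \<in> arr X" "src X h = src X k"
      "tgt X h = src X l" "l \<cdot>\<^bsub>X\<^esub> h = k" for k h l
    using that fibF_arr by (simp add: hom_def FibX_over_def)
  have bij: "bij_betw (amap (HB \<Gamma> B)) (hom ?FX k l) (hom ?FC (HB_obj \<Gamma> B k) (HB_obj \<Gamma> B l))"
    if "k \<in> F" "l \<in> F" "tgt X k = I\<^sub>0 B" "tgt X l = I\<^sub>0 B" for k l
    using adm that B fibF_arr
    by (simp add: admissible_def fully_faithful_def FibX_over_def HB_def)
  \<comment> \<open>The unit of the adjunction between slices, at \<open>f\<close>; it is hit by some \<open>d\<close> because the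
    right adjoint is full.\<close>
  obtain r where r: "r \<in> arr C" "src C r = A" "tgt C r = src C f1" "f1 \<cdot> r = f" "\<pi>1 \<cdot> r = \<eta> A"
    by (rule C.pullback_lift[OF pb1, of f A "\<eta> A"])
      (use f B unit_nat[of f A B] in \<open>simp_all add: hom_def\<close>)
  have "(f, r, f1) \<in> hom ?FC f f1"
    using r f f1 a1 fibE_arr by (simp add: hom_def Fib_over_def)
  then have "(f, r, f1) \<in> amap (HB \<Gamma> B) ` hom ?FX g (I\<^sub>1 f)"
    unfolding f_def f1_def bij_betw_imp_surj_on[OF bij[OF g(1) g1(1)[unfolded f_def] g(2)
      g1(2)[unfolded f_def]]] .
  then obtain D where D: "D \<in> hom ?FX g (I\<^sub>1 f)" "amap (HB \<Gamma> B) D = (f, r, f1)"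
    by (elim imageE) (rule that, assumption, rule sym)
  obtain d where d: "D = (g, d, I\<^sub>1 f)" "d \<in> arr X" "src X d = src X g" "tgt X d = I\<^sub>0 A"
    "I\<^sub>1 f \<cdot>\<^bsub>X\<^esub> d = g"
    using D(1) f by (cases D) (auto simp: hom_def FibX_over_def)
  define P where "P k h l m \<longleftrightarrow> m \<in> hom C (src C (HB_obj \<Gamma> B k)) (src C (HB_obj \<Gamma> B l)) \<and>
    HB_obj \<Gamma> B l \<cdot> m = HB_obj \<Gamma> B k \<and> HB_proj \<Gamma> B l \<cdot> m = H\<^sub>1 h \<cdot> HB_proj \<Gamma> B k" for k h l m
  have HB_eq: "amap (HB \<Gamma> B) (k, h, l) = (HB_obj \<Gamma> B k, (THE m. P k h l m), HB_obj \<Gamma> B l)" for k h l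
    by (simp add: HB_def P_def)
  have "\<exists>!m. P g d (I\<^sub>1 f) m"
  proof -
    have "\<eta> B \<cdot> f = H\<^sub>1 (I\<^sub>1 f) \<cdot> (H\<^sub>1 d \<cdot> \<pi>)"
      using C.extend[of "H\<^sub>1 (I\<^sub>1 f)" "H\<^sub>1 d" "H\<^sub>1 g" \<pi>] H_simps(6)[of d "I\<^sub>1 f"] d \<pi> f sq by simp
    moreover have "f \<in> hom C A (src C (\<eta> B))" "H\<^sub>1 d \<cdot> \<pi> \<in> hom C A (src C (H\<^sub>1 (I\<^sub>1 f)))"
      using f d \<pi> B by (simp_all add: hom_def)
    ultimately show ?thesis using pb1 f(5)
      unfolding is_pullback_def P_def f_def[symmetric] \<pi>_def[symmetric] f1_def[symmetric]
        \<pi>1_def[symmetric] A_def[symmetric] by blast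
  qed
  from theI'[OF this] D(2) have "P g d (I\<^sub>1 f) r" by (simp add: d(1) HB_eq)
  then have Hd: "H\<^sub>1 d \<cdot> \<pi> = \<eta> A"
    using r by (simp add: P_def f_def[symmetric] \<pi>_def[symmetric] \<pi>1_def[symmetric])
  have Hcd: "H\<^sub>1 (?c \<cdot>\<^bsub>X\<^esub> d) \<cdot> \<pi> = H\<^sub>1 (ide X (src X g)) \<cdot> \<pi>"
  proof -
    have "H\<^sub>1 (?c \<cdot>\<^bsub>X\<^esub> d) \<cdot> \<pi> = H\<^sub>1 ?c \<cdot> (H\<^sub>1 d \<cdot> \<pi>)"
      using H_simps(6)[of d ?c] c d \<pi> by simp
    then show ?thesis unfolding Hd Hc using \<pi> ga by simp
  qed
  \<comment> \<open>By \<open>Hcd\<close> both arrows have the same image under the faithful functor.\<close>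
  have cd: "?c \<cdot>\<^bsub>X\<^esub> d = ide X (src X g)"
  proof -
    have "amap (HB \<Gamma> B) (g, ?c \<cdot>\<^bsub>X\<^esub> d, g) = amap (HB \<Gamma> B) (g, ide X (src X g), g)"
      unfolding HB_eq P_def \<pi>_def[symmetric] Hcd ..
    moreover have "g \<cdot>\<^bsub>X\<^esub> (?c \<cdot>\<^bsub>X\<^esub> d) = g"
      using X.extend[OF gc, of d] c ga d by simp
    then have "(g, ?c \<cdot>\<^bsub>X\<^esub> d, g) \<in> hom ?FX g g" using c d ga g by (intro homX) simp_all
    moreover have "(g, ide X (src X g), g) \<in> hom ?FX g g" using ga g by (intro homX) simp_all
    ultimately show ?thesis
      using bij[OF g(1) g(1) g(2) g(2)] unfolding bij_betw_def inj_on_def by blast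
  qed
  have dc: "d \<cdot>\<^bsub>X\<^esub> ?c = ide X (I\<^sub>0 A)"
  proof (rule unit_cancel[of _ _ A])
    have "H\<^sub>1 (d \<cdot>\<^bsub>X\<^esub> ?c) \<cdot> \<eta> A = H\<^sub>1 d \<cdot> (H\<^sub>1 ?c \<cdot> \<eta> A)"
      using H_simps(6)[of ?c d] c d f by simp
    then show "H\<^sub>1 (d \<cdot>\<^bsub>X\<^esub> ?c) \<cdot> \<eta> A = H\<^sub>1 (ide X (I\<^sub>0 A)) \<cdot> \<eta> A"
      unfolding Hc Hd using f by simp
  qed (use c d f in simp_all)
  show ?thesis
    by (rule that[OF pb d(2,3), OF _ cd]) (use d dc f in simp_all)
qed

text \<open>
  The functor \<open>H\<^sup>B\<close> refers to one choice of pullbacks; the comparison isomorphism \<open>i\<close>, with inverse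
  \<open>j\<close>, transfers the conclusion to every pullback.
\<close>

lemma counit_iso:
  assumes pb: "is_pullback C f \<pi> (\<eta> B) (H\<^sub>1 g)" and B: "B \<in> obj C"
    and g: "g \<in> F" "tgt X g = I\<^sub>0 B"
  obtains d where "d \<in> arr X" "src X d = src X g" "tgt X d = I\<^sub>0 (src C f)"
    "(\<epsilon> (src X g) \<cdot>\<^bsub>X\<^esub> I\<^sub>1 \<pi>) \<cdot>\<^bsub>X\<^esub> d = ide X (src X g)"
    "d \<cdot>\<^bsub>X\<^esub> (\<epsilon> (src X g) \<cdot>\<^bsub>X\<^esub> I\<^sub>1 \<pi>) = ide X (I\<^sub>0 (src C f))"
proof -
  obtain f' \<pi>' d' where pb': "is_pullback C f' \<pi>' (\<eta> B) (H\<^sub>1 g)"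
    and d': "d' \<in> arr X" "src X d' = src X g" "tgt X d' = I\<^sub>0 (src C f')"
    and e1: "(\<epsilon> (src X g) \<cdot>\<^bsub>X\<^esub> I\<^sub>1 \<pi>') \<cdot>\<^bsub>X\<^esub> d' = ide X (src X g)"
    and e2: "d' \<cdot>\<^bsub>X\<^esub> (\<epsilon> (src X g) \<cdot>\<^bsub>X\<^esub> I\<^sub>1 \<pi>') = ide X (I\<^sub>0 (src C f'))"
    by (rule counit_iso_of_chosen_pullback[OF B g])
  note a = C.pullback_arr[OF pb] and a' = C.pullback_arr[OF pb']
  have ga: "g \<in> arr X" "src X g \<in> obj X" using g(1) fibF_arr by auto
  obtain i where i: "i \<in> arr C" "src C i = src C f" "tgt C i = src C f'" "f' \<cdot> i = f" "\<pi>' \<cdot> i = \<pi>"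
    by (rule C.pullback_lift[OF pb', of f "src C f" \<pi>]) (use a B in \<open>simp_all add: hom_def\<close>)
  obtain j where j: "j \<in> arr C" "src C j = src C f'" "tgt C j = src C f" "f \<cdot> j = f'" "\<pi> \<cdot> j = \<pi>'"
    by (rule C.pullback_lift[OF pb, of f' "src C f'" \<pi>']) (use a' B in \<open>simp_all add: hom_def\<close>)
  have ji: "j \<cdot> i = ide C (src C f)"
    by (rule C.pullback_jointly_monic[OF pb])
      (use i(1-3) j(1-3) a in \<open>simp_all add: i(4,5) C.extend[OF j(4)] C.extend[OF j(5)]\<close>)
  have \<pi>: "I\<^sub>1 \<pi>' \<cdot>\<^bsub>X\<^esub> I\<^sub>1 i = I\<^sub>1 \<pi>" using I_simps(6)[of i \<pi>'] i a' by simp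
  have \<pi>': "I\<^sub>1 \<pi> \<cdot>\<^bsub>X\<^esub> I\<^sub>1 j = I\<^sub>1 \<pi>'" using I_simps(6)[of j \<pi>] j a by simp
  have ij: "I\<^sub>1 j \<cdot>\<^bsub>X\<^esub> I\<^sub>1 i = ide X (I\<^sub>0 (src C f))"
    using I_simps(6)[of i j] i(1-3) j(1-3) a(1) ji by simp
  have \<pi>0: "\<pi> \<in> arr C" "src C \<pi> = src C f" "tgt C \<pi> = H\<^sub>0 (src X g)"
    and \<pi>0': "\<pi>' \<in> arr C" "src C \<pi>' = src C f'" "tgt C \<pi>' = H\<^sub>0 (src X g)"
    and f: "src C f \<in> obj C" "src C f' \<in> obj C"
    using a a' ga by simp_all
  show ?thesis
  proof (rule that[of "I\<^sub>1 j \<cdot>\<^bsub>X\<^esub> d'"])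
    have "(\<epsilon> (src X g) \<cdot>\<^bsub>X\<^esub> I\<^sub>1 \<pi>) \<cdot>\<^bsub>X\<^esub> (I\<^sub>1 j \<cdot>\<^bsub>X\<^esub> d') = (\<epsilon> (src X g) \<cdot>\<^bsub>X\<^esub> I\<^sub>1 \<pi>') \<cdot>\<^bsub>X\<^esub> d'"
      using j(1-3) d' \<pi>0 \<pi>0' ga f by (simp add: X.extend[OF \<pi>'])
    then show "(\<epsilon> (src X g) \<cdot>\<^bsub>X\<^esub> I\<^sub>1 \<pi>) \<cdot>\<^bsub>X\<^esub> (I\<^sub>1 j \<cdot>\<^bsub>X\<^esub> d') = ide X (src X g)"
      unfolding e1 .
    have "(I\<^sub>1 j \<cdot>\<^bsub>X\<^esub> d') \<cdot>\<^bsub>X\<^esub> (\<epsilon> (src X g) \<cdot>\<^bsub>X\<^esub> I\<^sub>1 \<pi>)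
      = I\<^sub>1 j \<cdot>\<^bsub>X\<^esub> ((d' \<cdot>\<^bsub>X\<^esub> (\<epsilon> (src X g) \<cdot>\<^bsub>X\<^esub> I\<^sub>1 \<pi>')) \<cdot>\<^bsub>X\<^esub> I\<^sub>1 i)"
      using i(1-3) j(1-3) d' \<pi>0 \<pi>0' ga f by (simp add: \<pi>)
    also have "\<dots> = ide X (I\<^sub>0 (src C f))"
      unfolding e2 using i(1-3) j(1-3) f ij by simp
    finally show "(I\<^sub>1 j \<cdot>\<^bsub>X\<^esub> d') \<cdot>\<^bsub>X\<^esub> (\<epsilon> (src X g) \<cdot>\<^bsub>X\<^esub> I\<^sub>1 \<pi>) = ide X (I\<^sub>0 (src C f))" .
  qed (use j(1-3) d' in simp_all)
qed

lemma trivial_iff: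
  "trivial_extension \<Gamma> f \<longleftrightarrow>
    f \<in> E \<and> is_pullback C f (\<eta> (src C f)) (\<eta> (tgt C f)) (H\<^sub>1 (I\<^sub>1 f))"
  by (simp add: trivial_extension_def)

text \<open>
  This is the criterion by which all trivial extensions are recognised. The isomorphism
  \<open>c = \<epsilon> I \<pi>\<close> satisfies \<open>g c = I f\<close> and \<open>H c \<eta> = \<pi>\<close>, so it identifies the given pullback square
  with the naturality square of \<open>\<eta>\<close> at \<open>f\<close>.
\<close>

lemma trivial_of_pullback:
  assumes pb: "is_pullback C f \<pi> (\<eta> B) (H\<^sub>1 g)" and B: "B \<in> obj C"
    and g: "g \<in> F" "tgt X g = I\<^sub>0 B"
  shows "trivial_extension \<Gamma> f"
proof -
  obtain d where d: "d \<in> arr X" "src X d = src X g" "tgt X d = I\<^sub>0 (src C f)"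
    and cd: "(\<epsilon> (src X g) \<cdot>\<^bsub>X\<^esub> I\<^sub>1 \<pi>) \<cdot>\<^bsub>X\<^esub> d = ide X (src X g)"
    and dc: "d \<cdot>\<^bsub>X\<^esub> (\<epsilon> (src X g) \<cdot>\<^bsub>X\<^esub> I\<^sub>1 \<pi>) = ide X (I\<^sub>0 (src C f))"
    by (rule counit_iso[OF pb B g])
  note a = C.pullback_arr[OF pb]
  define A where "A = src C f"
  define c where "c = \<epsilon> (src X g) \<cdot>\<^bsub>X\<^esub> I\<^sub>1 \<pi>"
  have ga: "g \<in> arr X" "src X g \<in> obj X" using g(1) fibF_arr by auto
  have fE: "f \<in> E" using fibE_pullback[OF pb H_fib[OF g(1)]] .
  have f: "f \<in> arr C" "src C f = A" "tgt C f = B" "A \<in> obj C" using a B by (simp_all add: A_def)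
  have \<pi>: "\<pi> \<in> arr C" "src C \<pi> = A" "tgt C \<pi> = H\<^sub>0 (src X g)" using a ga by (simp_all add: A_def)
  have c: "c \<in> arr X" "src X c = I\<^sub>0 A" "tgt X c = src X g" using \<pi> ga by (simp_all add: c_def)
  have d': "tgt X d = I\<^sub>0 A" using d f by simp
  have Hc: "H\<^sub>1 c \<cdot> \<eta> A = \<pi>" unfolding c_def using \<pi> ga by (intro transpose) simp_all
  have sq: "\<eta> B \<cdot> f = H\<^sub>1 g \<cdot> \<pi>" by (rule a(9))
  have dc': "H\<^sub>1 d \<cdot> H\<^sub>1 c = ide C (H\<^sub>0 (I\<^sub>0 A))"
    using H_simps(6)[of c d] dc[folded c_def] c d d' f by simp
  have gc: "g \<cdot>\<^bsub>X\<^esub> c = I\<^sub>1 f"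
  proof (rule unit_cancel[of _ _ A])
    have "H\<^sub>1 (g \<cdot>\<^bsub>X\<^esub> c) \<cdot> \<eta> A = H\<^sub>1 g \<cdot> (H\<^sub>1 c \<cdot> \<eta> A)"
      using H_simps(6)[of c g] c ga f by simp
    then show "H\<^sub>1 (g \<cdot>\<^bsub>X\<^esub> c) \<cdot> \<eta> A = H\<^sub>1 (I\<^sub>1 f) \<cdot> \<eta> A"
      unfolding Hc sq[symmetric] using unit_nat[of f A B] f by simp
  qed (use c ga f g in simp_all)
  have Hgc: "H\<^sub>1 g \<cdot> H\<^sub>1 c = H\<^sub>1 (I\<^sub>1 f)" using H_simps(6)[of c g] gc c ga by simp
  have "is_pullback C f (\<eta> A) (\<eta> B) (H\<^sub>1 (I\<^sub>1 f))"
  proof (rule C.pullbackI)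
    show "\<eta> B \<cdot> f = H\<^sub>1 (I\<^sub>1 f) \<cdot> \<eta> A" using f unit_nat by simp
  next
    fix u v
    assume h: "u \<in> arr C" "v \<in> arr C" "src C v = src C u" "tgt C u = src C (\<eta> B)"
      "tgt C v = src C (H\<^sub>1 (I\<^sub>1 f))" and e: "\<eta> B \<cdot> u = H\<^sub>1 (I\<^sub>1 f) \<cdot> v"
    have v: "tgt C v = H\<^sub>0 (I\<^sub>0 A)" and u: "tgt C u = B" using h f B by simp_all
    have "H\<^sub>1 g \<cdot> (H\<^sub>1 c \<cdot> v) = \<eta> B \<cdot> u"
      using h(1-3) u v c ga e by (simp add: C.extend[OF Hgc])
    then obtain w where w: "w \<in> arr C" "src C w = src C u" "tgt C w = A"
      "f \<cdot> w = u" "\<pi> \<cdot> w = H\<^sub>1 c \<cdot> v"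
      unfolding A_def
      by (rule C.pullback_lift[OF pb, rotated -2, OF sym]) (use h(1-3) u v c ga B in \<open>simp_all add: hom_def\<close>)
    have "\<eta> A \<cdot> w = H\<^sub>1 d \<cdot> (H\<^sub>1 c \<cdot> (\<eta> A \<cdot> w))"
      using w(1-3) c d d' f by (simp add: C.extend[OF dc'])
    also have "\<dots> = H\<^sub>1 d \<cdot> (H\<^sub>1 c \<cdot> v)"
      using w c f by (simp add: C.extend[OF Hc])
    also have "\<dots> = v" using h(1-3) v c d d' f by (simp add: C.extend[OF dc'])
    finally show "\<exists>w \<in> hom C (src C u) (src C f). f \<cdot> w = u \<and> \<eta> A \<cdot> w = v"
      using w f by (intro bexI[of _ w]) (simp_all add: hom_def)
  next
    fix u v
    assume h: "u \<in> arr C" "v \<in> arr C" "src C v = src C u" "tgt C u = src C f" "tgt C v = src C f"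
      and e: "f \<cdot> u = f \<cdot> v" "\<eta> A \<cdot> u = \<eta> A \<cdot> v"
    have "\<pi> \<cdot> u = H\<^sub>1 c \<cdot> (\<eta> A \<cdot> u)" "\<pi> \<cdot> v = H\<^sub>1 c \<cdot> (\<eta> A \<cdot> v)"
      using h f c by (simp_all add: C.extend[OF Hc])
    then have "\<pi> \<cdot> u = \<pi> \<cdot> v" unfolding e(2) by simp
    with e(1) show "u = v" by (rule C.pullback_jointly_monic[OF pb h(1,4,2,5,3)])
  qed (use f B in simp_all)
  then show ?thesis using fE f by (simp add: trivial_iff)
qed

text \<open>
  Pasting the given square with the naturality square of \<open>g\<close> exhibits \<open>p\<close> as the pullback of \<open>H I g\<close>
  along \<open>\<eta> k = H I k \<eta>\<close>. As \<open>H\<close> preserves pullbacks, this is the pullback along \<open>\<eta>\<close> of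
  \<open>H g0\<close>, where \<open>g0\<close> is the pullback of \<open>I g\<close> along \<open>I k\<close>.
\<close>

lemma trivial_pullback_stable:
  assumes g: "trivial_extension \<Gamma> g" and pb: "is_pullback C p q k g"
  shows "trivial_extension \<Gamma> p"
proof -
  define A Y Z W where "A = src C g" and "Y = tgt C g" and "Z = src C k" and "W = src C p"
  note a = C.pullback_arr[OF pb]
  have t: "g \<in> E" "is_pullback C g (\<eta> A) (\<eta> Y) (H\<^sub>1 (I\<^sub>1 g))"
    using g by (simp_all add: trivial_iff A_def Y_def)
  have ar: "g \<in> arr C" "src C g = A" "tgt C g = Y" "k \<in> arr C" "src C k = Z" "tgt C k = Y"
    "p \<in> arr C" "src C p = W" "tgt C p = Z" "q \<in> arr C" "src C q = W" "tgt C q = A"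
    "A \<in> obj C" "Y \<in> obj C" "Z \<in> obj C" "W \<in> obj C"
    using a by (simp_all add: A_def Y_def Z_def W_def)
  have sq: "k \<cdot> p = g \<cdot> q" by (rule a(9))
  obtain g0 k0 where pb0: "is_pullback X g0 k0 (I\<^sub>1 k) (I\<^sub>1 g)"
    using pullbacks(2)[unfolded has_pullbacks_def, rule_format, of "I\<^sub>1 k" "I\<^sub>1 g"] ar by auto
  note a0 = X.pullback_arr[OF pb0]
  define V where "V = src X g0"
  have ar0: "g0 \<in> arr X" "src X g0 = V" "tgt X g0 = I\<^sub>0 Z" "k0 \<in> arr X" "src X k0 = V"
    "tgt X k0 = I\<^sub>0 A"
    using a0 ar by (simp_all add: V_def)
  have V: "V \<in> obj X" using ar0(1,2) X.src_obj by blast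
  have g0: "g0 \<in> F" using fibF_pullback[OF pb0 I_fib[OF t(1)]] .
  note pbH = H_preserves_pullback[OF pb0]
  have sq0: "H\<^sub>1 (I\<^sub>1 k) \<cdot> H\<^sub>1 g0 = H\<^sub>1 (I\<^sub>1 g) \<cdot> H\<^sub>1 k0" by (rule C.pullback_arr(9)[OF pbH])
  have nk: "\<eta> Y \<cdot> k = H\<^sub>1 (I\<^sub>1 k) \<cdot> \<eta> Z" and ng: "\<eta> Y \<cdot> g = H\<^sub>1 (I\<^sub>1 g) \<cdot> \<eta> A"
    using ar unit_nat by simp_all
  have "H\<^sub>1 (I\<^sub>1 k) \<cdot> (\<eta> Z \<cdot> p) = \<eta> Y \<cdot> (k \<cdot> p)" using ar by (simp add: C.extend[OF nk])
  also have "\<dots> = H\<^sub>1 (I\<^sub>1 g) \<cdot> (\<eta> A \<cdot> q)" unfolding sq using ar by (simp add: C.extend[OF ng])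
  finally have "H\<^sub>1 (I\<^sub>1 k) \<cdot> (\<eta> Z \<cdot> p) = H\<^sub>1 (I\<^sub>1 g) \<cdot> (\<eta> A \<cdot> q)" .
  then obtain \<pi> where \<pi>: "\<pi> \<in> arr C" "src C \<pi> = W" "tgt C \<pi> = H\<^sub>0 V"
    "H\<^sub>1 g0 \<cdot> \<pi> = \<eta> Z \<cdot> p" "H\<^sub>1 k0 \<cdot> \<pi> = \<eta> A \<cdot> q"
    by (rule C.pullback_lift[OF pbH, rotated -2]) (use ar ar0 in \<open>simp_all add: hom_def\<close>)
  have "is_pullback C p \<pi> (\<eta> Z) (H\<^sub>1 g0)"
  proof (rule C.pullbackI)
    show "\<eta> Z \<cdot> p = H\<^sub>1 g0 \<cdot> \<pi>" using \<pi>(4) by (rule sym)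
  next
    fix u v
    assume "u \<in> arr C" "v \<in> arr C" "src C v = src C u" "tgt C u = src C (\<eta> Z)"
      "tgt C v = src C (H\<^sub>1 g0)" and e: "\<eta> Z \<cdot> u = H\<^sub>1 g0 \<cdot> v"
    then have h: "u \<in> arr C" "v \<in> arr C" "src C v = src C u" "tgt C u = Z" "tgt C v = H\<^sub>0 V"
      using ar ar0 by simp_all
    have "\<eta> Y \<cdot> (k \<cdot> u) = H\<^sub>1 (I\<^sub>1 k) \<cdot> (\<eta> Z \<cdot> u)" using ar h by (simp add: C.extend[OF nk])
    also have "\<dots> = H\<^sub>1 (I\<^sub>1 g) \<cdot> (H\<^sub>1 k0 \<cdot> v)"
      unfolding e using ar ar0 h by (simp add: C.extend[OF sq0])
    finally obtain x where x: "x \<in> arr C" "src C x = src C u" "tgt C x = A"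
      "g \<cdot> x = k \<cdot> u" "\<eta> A \<cdot> x = H\<^sub>1 k0 \<cdot> v"
      unfolding A_def
      by (rule C.pullback_lift[OF t(2), rotated -2]) (use ar ar0 h in \<open>simp_all add: hom_def\<close>)
    obtain w where w: "w \<in> arr C" "src C w = src C u" "tgt C w = W" "p \<cdot> w = u" "q \<cdot> w = x"
      unfolding W_def
      by (rule C.pullback_lift[OF pb, of u "src C u" x]) (use ar h x in \<open>simp_all add: hom_def\<close>)
    have "\<pi> \<cdot> w = v"
    proof (rule C.pullback_jointly_monic[OF pbH])
      show "H\<^sub>1 g0 \<cdot> (\<pi> \<cdot> w) = H\<^sub>1 g0 \<cdot> v"
        using w ar ar0 \<pi>(1-3) e by (simp add: C.extend[OF \<pi>(4)])
      show "H\<^sub>1 k0 \<cdot> (\<pi> \<cdot> w) = H\<^sub>1 k0 \<cdot> v"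
        using w ar ar0 \<pi>(1-3) x by (simp add: C.extend[OF \<pi>(5)])
    qed (use w ar ar0 \<pi>(1-3) h in simp_all)
    then show "\<exists>w \<in> hom C (src C u) (src C p). p \<cdot> w = u \<and> \<pi> \<cdot> w = v"
      using w ar by (intro bexI[of _ w]) (simp_all add: hom_def)
  next
    fix u v
    assume h: "u \<in> arr C" "v \<in> arr C" "src C v = src C u" "tgt C u = src C p" "tgt C v = src C p"
      and e: "p \<cdot> u = p \<cdot> v" "\<pi> \<cdot> u = \<pi> \<cdot> v"
    have "g \<cdot> (q \<cdot> u) = k \<cdot> (p \<cdot> u)" "g \<cdot> (q \<cdot> v) = k \<cdot> (p \<cdot> v)"
      using h ar by (simp_all add: C.extend[OF sq])
    then have 1: "g \<cdot> (q \<cdot> u) = g \<cdot> (q \<cdot> v)" unfolding e(1) by simp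
    have "\<eta> A \<cdot> (q \<cdot> u) = H\<^sub>1 k0 \<cdot> (\<pi> \<cdot> u)" "\<eta> A \<cdot> (q \<cdot> v) = H\<^sub>1 k0 \<cdot> (\<pi> \<cdot> v)"
      using h ar ar0 \<pi>(1-3) by (simp_all add: C.extend[OF \<pi>(5)])
    then have 2: "\<eta> A \<cdot> (q \<cdot> u) = \<eta> A \<cdot> (q \<cdot> v)" unfolding e(2) by simp
    have "q \<cdot> u = q \<cdot> v"
      by (rule C.pullback_jointly_monic[OF t(2) _ _ _ _ _ 1 2]) (use h ar in simp_all)
    with e(1) show "u = v" by (rule C.pullback_jointly_monic[OF pb h(1,4,2,5,3)])
  qed (use ar ar0 \<pi>(1-3) in simp_all)
  then show ?thesis by (rule trivial_of_pullback) (use g0 ar ar0 in simp_all)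
qed

text \<open>
  The kernel pair projections of \<open>t\<close> are pullbacks of \<open>t\<close>.
\<close>

lemma trivial_imp_normal:
  assumes t: "trivial_extension \<Gamma> t"
  shows "normal_extension \<Gamma> t"
proof -
  have tE: "t \<in> E" using t by (simp add: trivial_iff)
  obtain p q where pb: "is_pullback C p q t t"
    by (rule pullback_exists[of t t]) (use fibE_arr[OF tE] in simp_all)
  have "trivial_extension \<Gamma> p" by (rule trivial_pullback_stable[OF t pb])
  moreover have "trivial_extension \<Gamma> q"
    by (rule trivial_pullback_stable[OF t C.pullback_sym[OF pb]])
  ultimately show ?thesis using tE pb unfolding normal_extension_def is_kernel_pair_def by auto
qed

subsection \<open>The trivial reflection\<close>

text \<open>
  Allowing an arbitrary bottom \<open>k\<close> makes the reflection functorial on squares, hence applicable to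
  a reflexive graph of fibrations.
\<close>

definition trivial_reflection where
  "trivial_reflection f t r \<longleftrightarrow>
    trivial_extension \<Gamma> t \<and> tgt C t = tgt C f \<and> r \<in> hom C (src C f) (src C t) \<and> t \<cdot> r = f \<and>
    (\<forall>g h k. trivial_extension \<Gamma> g \<longrightarrow> h \<in> hom C (src C f) (src C g) \<longrightarrow>
       k \<in> hom C (tgt C f) (tgt C g) \<longrightarrow> g \<cdot> h = k \<cdot> f \<longrightarrow>
       (\<exists>!w. w \<in> hom C (src C t) (src C g) \<and> w \<cdot> r = h \<and> g \<cdot> w = k \<cdot> t))"

lemma trivial_reflection_arr:
  assumes "trivial_reflection f t r"
  shows "t \<in> E" "t \<in> arr C" "tgt C t = tgt C f" "r \<in> arr C" "src C r = src C f"
    "tgt C r = src C t" "t \<cdot> r = f"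
  using assms fibE_arr by (auto simp: trivial_reflection_def trivial_iff hom_def)

lemma trivial_reflection_lift:
  assumes "trivial_reflection f t r" "trivial_extension \<Gamma> g" "h \<in> hom C (src C f) (src C g)"
    "k \<in> hom C (tgt C f) (tgt C g)" "g \<cdot> h = k \<cdot> f"
  obtains w where "w \<in> arr C" "src C w = src C t" "tgt C w = src C g" "w \<cdot> r = h" "g \<cdot> w = k \<cdot> t"
proof -
  have "\<exists>!w. w \<in> hom C (src C t) (src C g) \<and> w \<cdot> r = h \<and> g \<cdot> w = k \<cdot> t"
    using assms unfolding trivial_reflection_def by blast
  then show ?thesis using that by (auto simp: hom_def)
qed

lemma trivial_reflection_unique:
  assumes T: "trivial_reflection f t r" and g: "trivial_extension \<Gamma> g"
    and k: "k \<in> hom C (tgt C f) (tgt C g)"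
    and w: "w \<in> hom C (src C t) (src C g)" "g \<cdot> w = k \<cdot> t"
    and w': "w' \<in> hom C (src C t) (src C g)" "g \<cdot> w' = k \<cdot> t"
    and eq: "w \<cdot> r = w' \<cdot> r"
  shows "w = w'"
proof -
  note a = trivial_reflection_arr[OF T]
  have ga: "g \<in> arr C" using g fibE_arr by (simp add: trivial_iff)
  have wa: "w \<in> arr C" "src C w = src C t" "tgt C w = src C g"
    and ka: "k \<in> arr C" "src C k = tgt C f" "tgt C k = tgt C g"
    using w k by (simp_all add: hom_def)
  have "g \<cdot> (w \<cdot> r) = k \<cdot> f"
    using C.extend[OF w(2), of r] wa ka a ga by simp
  moreover have "w \<cdot> r \<in> hom C (src C f) (src C g)" using wa a by (simp add: hom_def)
  ultimately have "\<exists>!z. z \<in> hom C (src C t) (src C g) \<and> z \<cdot> r = w \<cdot> r \<and> g \<cdot> z = k \<cdot> t"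
    using T g k unfolding trivial_reflection_def by blast
  then show ?thesis using w w' eq by (metis (no_types))
qed

text \<open>
  The reflection of \<open>f\<close> is the pullback \<open>t\<close> of \<open>H I f\<close> along \<open>\<eta>\<close>. A square from \<open>f\<close> to a trivial \<open>g\<close>
  extends along \<open>r\<close> because \<open>g\<close> is a pullback of \<open>H I g\<close>, and the extension is unique because \<open>I r\<close>
  is invertible.
\<close>

lemma trivial_reflection_exists:
  assumes fE: "f \<in> E"
  obtains t r where "trivial_reflection f t r"
proof -
  define A B where "A = src C f" and "B = tgt C f"
  have f: "f \<in> arr C" "src C f = A" "tgt C f = B" "A \<in> obj C" "B \<in> obj C"
    using fibE_arr[OF fE] by (simp_all add: A_def B_def)
  obtain t \<pi> where pb: "is_pullback C t \<pi> (\<eta> B) (H\<^sub>1 (I\<^sub>1 f))"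
    by (rule pullback_exists[of "\<eta> B" "H\<^sub>1 (I\<^sub>1 f)"]) (use f in simp_all)
  note a = C.pullback_arr[OF pb]
  define T where "T = src C t"
  have t: "t \<in> arr C" "src C t = T" "tgt C t = B" "T \<in> obj C"
    "\<pi> \<in> arr C" "src C \<pi> = T" "tgt C \<pi> = H\<^sub>0 (I\<^sub>0 A)"
    using a f by (simp_all add: T_def)
  have sq: "H\<^sub>1 (I\<^sub>1 f) \<cdot> \<pi> = \<eta> B \<cdot> t" by (rule a(9)[symmetric])
  have triv: "trivial_extension \<Gamma> t"
    by (rule trivial_of_pullback[OF pb]) (use f I_fib[OF fE] in simp_all)
  let ?c = "\<epsilon> (I\<^sub>0 A) \<cdot>\<^bsub>X\<^esub> I\<^sub>1 \<pi>"
  obtain d where d: "d \<in> arr X" "src X d = I\<^sub>0 A" "tgt X d = I\<^sub>0 T"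
    and dc: "d \<cdot>\<^bsub>X\<^esub> ?c = ide X (I\<^sub>0 T)"
    by (rule counit_iso[OF pb f(5) I_fib[OF fE]]) (use f t in simp_all)
  have nf: "\<eta> B \<cdot> f = H\<^sub>1 (I\<^sub>1 f) \<cdot> \<eta> A" using f unit_nat by simp
  obtain r where r: "r \<in> arr C" "src C r = A" "tgt C r = T" "t \<cdot> r = f" "\<pi> \<cdot> r = \<eta> A"
    unfolding T_def
    by (rule C.pullback_lift[OF pb, of f A "\<eta> A"]) (use f nf in \<open>simp_all add: hom_def\<close>)
  have I\<pi>: "I\<^sub>1 \<pi> \<cdot>\<^bsub>X\<^esub> I\<^sub>1 r = I\<^sub>1 (\<eta> A)" using I_simps(6)[of r \<pi>] r t by simp
  have Ird: "I\<^sub>1 r = d"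
  proof -
    have "I\<^sub>1 r = (d \<cdot>\<^bsub>X\<^esub> ?c) \<cdot>\<^bsub>X\<^esub> I\<^sub>1 r" unfolding dc using r(1-3) by simp
    also have "\<dots> = d \<cdot>\<^bsub>X\<^esub> (\<epsilon> (I\<^sub>0 A) \<cdot>\<^bsub>X\<^esub> I\<^sub>1 (\<eta> A))"
      using d r(1-3) t f by (simp add: I\<pi>)
    finally show ?thesis using triangles(1)[of A] f d by simp
  qed
  \<comment> \<open>\<open>I r\<close> is invertible; this makes extensions along \<open>r\<close> unique.\<close>
  have Ir: "I\<^sub>1 r \<cdot>\<^bsub>X\<^esub> ?c = ide X (I\<^sub>0 T)" unfolding Ird by (rule dc)
  have c: "?c \<in> arr X" "src X ?c = I\<^sub>0 T" "tgt X ?c = I\<^sub>0 A" using t f by simp_all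
  have det: "I\<^sub>1 w = I\<^sub>1 (w \<cdot> r) \<cdot>\<^bsub>X\<^esub> ?c" if "w \<in> arr C" "src C w = T" for w
  proof -
    have "I\<^sub>1 (w \<cdot> r) \<cdot>\<^bsub>X\<^esub> ?c = I\<^sub>1 w \<cdot>\<^bsub>X\<^esub> (I\<^sub>1 r \<cdot>\<^bsub>X\<^esub> ?c)" using that r(1-3) c t f by simp
    then show ?thesis unfolding Ir using that by simp
  qed
  have "trivial_reflection f t r"
    unfolding trivial_reflection_def
  proof (intro conjI allI impI)
    fix g h k
    assume g: "trivial_extension \<Gamma> g" and "h \<in> hom C (src C f) (src C g)"
      "k \<in> hom C (tgt C f) (tgt C g)" and e: "g \<cdot> h = k \<cdot> f"
    then have h: "h \<in> arr C" "src C h = A" "tgt C h = src C g"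
      and k: "k \<in> arr C" "src C k = B" "tgt C k = tgt C g"
      using f by (simp_all add: hom_def)
    have ga: "g \<in> arr C" using g fibE_arr by (simp add: trivial_iff)
    have pg: "is_pullback C g (\<eta> (src C g)) (\<eta> (tgt C g)) (H\<^sub>1 (I\<^sub>1 g))" using g by (simp add: trivial_iff)
    have nk: "\<eta> (tgt C g) \<cdot> k = H\<^sub>1 (I\<^sub>1 k) \<cdot> \<eta> B" and nh: "\<eta> (src C g) \<cdot> h = H\<^sub>1 (I\<^sub>1 h) \<cdot> \<eta> A"
      using h k unit_nat by simp_all
    have HI: "H\<^sub>1 (I\<^sub>1 g) \<cdot> H\<^sub>1 (I\<^sub>1 h) = H\<^sub>1 (I\<^sub>1 k) \<cdot> H\<^sub>1 (I\<^sub>1 f)"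
    proof -
      have "H\<^sub>1 (I\<^sub>1 (g \<cdot> h)) = H\<^sub>1 (I\<^sub>1 (k \<cdot> f))" unfolding e ..
      then show ?thesis using h k f ga by simp
    qed
    have "\<eta> (tgt C g) \<cdot> (k \<cdot> t) = H\<^sub>1 (I\<^sub>1 k) \<cdot> (\<eta> B \<cdot> t)"
      using k t f ga by (simp add: C.extend[OF nk])
    also have "\<dots> = H\<^sub>1 (I\<^sub>1 g) \<cdot> (H\<^sub>1 (I\<^sub>1 h) \<cdot> \<pi>)"
      unfolding sq[symmetric] using h k t f ga by (simp add: C.extend[OF HI])
    finally obtain w where w: "w \<in> arr C" "src C w = T" "tgt C w = src C g"
      "g \<cdot> w = k \<cdot> t" "\<eta> (src C g) \<cdot> w = H\<^sub>1 (I\<^sub>1 h) \<cdot> \<pi>"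
      by (rule C.pullback_lift[OF pg, rotated -2]) (use h k t f ga in \<open>simp_all add: hom_def\<close>)
    have "w \<cdot> r = h"
    proof (rule C.pullback_jointly_monic[OF pg])
      show "g \<cdot> (w \<cdot> r) = g \<cdot> h"
        using w(1-3) r h k t f ga e by (simp add: C.extend[OF w(4)])
      show "\<eta> (src C g) \<cdot> (w \<cdot> r) = \<eta> (src C g) \<cdot> h"
        using w(1-3) r h k t f ga nh by (simp add: C.extend[OF w(5)])
    qed (use w r h in simp_all)
    show "\<exists>!w. w \<in> hom C (src C t) (src C g) \<and> w \<cdot> r = h \<and> g \<cdot> w = k \<cdot> t"
    proof (rule ex1I[of _ w])
      fix w' assume "w' \<in> hom C (src C t) (src C g) \<and> w' \<cdot> r = h \<and> g \<cdot> w' = k \<cdot> t"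
      then have w': "w' \<in> arr C" "src C w' = T" "tgt C w' = src C g" "w' \<cdot> r = h" "g \<cdot> w' = k \<cdot> t"
        using t by (simp_all add: hom_def)
      have "I\<^sub>1 w' = I\<^sub>1 w"
        unfolding det[OF w'(1,2)] det[OF w(1,2)] w'(4) \<open>w \<cdot> r = h\<close> ..
      then have "\<eta> (src C g) \<cdot> w' = \<eta> (src C g) \<cdot> w"
        using unit_nat[OF w'(1-3)] unit_nat[OF w(1-3)] by simp
      then show "w' = w"
        using w w' by (intro C.pullback_jointly_monic[OF pg, of w' w]) simp_all
    qed (use w \<open>w \<cdot> r = h\<close> t in \<open>simp add: hom_def\<close>)
  qed (use triv t r f in \<open>simp_all add: hom_def\<close>)
  then show ?thesis by (rule that)
qed

text \<open>
  Normality of \<open>n\<close> means that its kernel pair projection \<open>p\<close> is trivial. Over a base map of the form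
  \<open>n v\<close>, a map \<open>x\<close> into the domain of \<open>n\<close> amounts to the map \<open>(v f, x)\<close> into the kernel pair, which is
  a square from \<open>f\<close> to \<open>p\<close> with bottom \<open>v\<close>. Thus the universal property of trivial reflections
  carries over from \<open>p\<close> to \<open>n\<close>.
\<close>

lemma normal_lift:
  assumes T: "trivial_reflection f t r" and n: "normal_extension \<Gamma> n"
    and x: "x \<in> hom C (src C f) (src C n)" and v: "v \<in> hom C (tgt C f) (src C n)"
    and eq: "n \<cdot> x = n \<cdot> (v \<cdot> f)"
  obtains y where "y \<in> arr C" "src C y = src C t" "tgt C y = src C n"
    "y \<cdot> r = x" "n \<cdot> y = n \<cdot> (v \<cdot> t)"
proof -
  obtain p q where pb: "is_pullback C p q n n" and p: "trivial_extension \<Gamma> p"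
    using n by (auto simp: normal_extension_def is_kernel_pair_def)
  note a = trivial_reflection_arr[OF T] and b = C.pullback_arr[OF pb]
  have fa: "f \<in> arr C" using a C.arr_cmp[of r t] by simp
  have va: "v \<in> arr C" "src C v = tgt C f" "tgt C v = src C n"
    and xa: "x \<in> arr C" "src C x = src C f" "tgt C x = src C n"
    using v x by (simp_all add: hom_def)
  obtain z where z: "z \<in> arr C" "src C z = src C f" "tgt C z = src C p" "p \<cdot> z = v \<cdot> f" "q \<cdot> z = x"
    by (rule C.pullback_lift[OF pb, of "v \<cdot> f" "src C f" x]) (use fa va xa eq in \<open>simp_all add: hom_def\<close>)
  obtain w where w: "w \<in> arr C" "src C w = src C t" "tgt C w = src C p" "w \<cdot> r = z" "p \<cdot> w = v \<cdot> t"
    by (rule trivial_reflection_lift[OF T p, of z v]) (use z va b in \<open>simp_all add: hom_def\<close>)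
  show ?thesis
  proof (rule that[of "q \<cdot> w"])
    show "(q \<cdot> w) \<cdot> r = x" using w z b a by simp
    have "n \<cdot> (q \<cdot> w) = n \<cdot> (p \<cdot> w)" using w(1-3) b by (simp add: C.extend[OF b(9)])
    then show "n \<cdot> (q \<cdot> w) = n \<cdot> (v \<cdot> t)" unfolding w(5) .
  qed (use w b in simp_all)
qed

lemma normal_unique:
  assumes T: "trivial_reflection f t r" and n: "normal_extension \<Gamma> n"
    and v: "v \<in> hom C (tgt C f) (src C n)"
    and y: "y \<in> hom C (src C t) (src C n)" "n \<cdot> y = n \<cdot> (v \<cdot> t)"
    and y': "y' \<in> hom C (src C t) (src C n)" "n \<cdot> y' = n \<cdot> (v \<cdot> t)"
    and eq: "y \<cdot> r = y' \<cdot> r"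
  shows "y = y'"
proof -
  obtain p q where pb: "is_pullback C p q n n" and p: "trivial_extension \<Gamma> p"
    using n by (auto simp: normal_extension_def is_kernel_pair_def)
  note a = trivial_reflection_arr[OF T] and b = C.pullback_arr[OF pb]
  have va: "v \<in> arr C" "src C v = tgt C f" "tgt C v = src C n"
    and ya: "y \<in> arr C" "src C y = src C t" "tgt C y = src C n"
    and ya': "y' \<in> arr C" "src C y' = src C t" "tgt C y' = src C n"
    using v y y' by (simp_all add: hom_def)
  have vt: "v \<cdot> t \<in> hom C (src C t) (src C n)" using va a by (simp add: hom_def)
  obtain w where w: "w \<in> arr C" "src C w = src C t" "tgt C w = src C p" "p \<cdot> w = v \<cdot> t" "q \<cdot> w = y"
    by (rule C.pullback_lift[OF pb vt y(1) y(2)[symmetric]])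
  obtain w' where w': "w' \<in> arr C" "src C w' = src C t" "tgt C w' = src C p" "p \<cdot> w' = v \<cdot> t" "q \<cdot> w' = y'"
    by (rule C.pullback_lift[OF pb vt y'(1) y'(2)[symmetric]])
  have "w = w'"
  proof (rule trivial_reflection_unique[OF T p])
    show "w \<cdot> r = w' \<cdot> r"
    proof (rule C.pullback_jointly_monic[OF pb])
      show "p \<cdot> (w \<cdot> r) = p \<cdot> (w' \<cdot> r)"
        using w(1-3) w'(1-3) b a by (simp add: C.extend[OF w(4)] C.extend[OF w'(4)])
      show "q \<cdot> (w \<cdot> r) = q \<cdot> (w' \<cdot> r)"
        using w(1-3) w'(1-3) b a eq by (simp add: C.extend[OF w(5)] C.extend[OF w'(5)])
    qed (use w(1-3) w'(1-3) a in simp_all)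
  qed (use w(1-4) w'(1-4) b va in \<open>simp_all add: hom_def\<close>)
  then show ?thesis using w(5) w'(5) by simp
qed

end

section \<open>The normal reflection\<close>

locale normal_galois = admissible_galois C X I H \<eta> \<epsilon> E F
  for C :: "('o, 'a) cat" (structure) and X :: "('p, 'b) cat" and I H \<eta> \<epsilon> E F +
  assumes fib_reg: "E = regular_epis C"
    and reflexive_coequalisers: "has_reflexive_coequalisers C"
    and closed: "closed_under_reflexive_coequalisers
      (Norm \<lparr>catC = C, catX = X, fI = I, fH = H, unit = \<eta>, counit = \<epsilon>, fibE = E, fibF = F\<rparr>)
      (Fib \<lparr>catC = C, catX = X, fI = I, fH = H, unit = \<eta>, counit = \<epsilon>, fibE = E, fibF = F\<rparr>)"
begin

lemma Fib_eq: "Fib \<Gamma> = full_subcat (arrow_cat C) E"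
  by (simp add: Fib_def)

lemma category_Fib: "category (Fib \<Gamma>)"
  unfolding Fib_eq by (intro category.category_full_subcat C.category_arrow_cat)

text \<open>
  Coequalisers of fibrations are computed separately on domains and codomains.
\<close>

lemma coequaliser_in_Fib:
  assumes E: "a \<in> E" "b \<in> E" "g \<in> E"
    and c: "is_coequaliser C x1 y1 c" and d: "is_coequaliser C x0 y0 d"
    and x: "(a, x1, x0, b) \<in> arr (arrow_cat C)" and y: "(a, y1, y0, b) \<in> arr (arrow_cat C)"
    and g: "src C g = tgt C c" "tgt C g = tgt C d" "g \<cdot> c = d \<cdot> b"
  shows "is_coequaliser (Fib \<Gamma>) (a, x1, x0, b) (a, y1, y0, b) (b, c, d, g)"
proof -
  interpret Fib: category "Fib \<Gamma>" by (rule category_Fib)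
  note Ea = E[THEN fibE_arr]
  have ca: "c \<in> arr C" "src C c = src C b" "c \<cdot> x1 = c \<cdot> y1"
    and da: "d \<in> arr C" "src C d = tgt C b" "d \<cdot> x0 = d \<cdot> y0"
    using c d x by (simp_all add: is_coequaliser_def)
  show ?thesis
  proof (rule Fib.coequaliserI)
    fix u assume u: "u \<in> arr (Fib \<Gamma>)" "src (Fib \<Gamma>) u = tgt (Fib \<Gamma>) (a, x1, x0, b)"
      and e: "u \<cdot>\<^bsub>Fib \<Gamma>\<^esub> (a, x1, x0, b) = u \<cdot>\<^bsub>Fib \<Gamma>\<^esub> (a, y1, y0, b)"
    obtain h k n where un: "u = (b, h, k, n)" using u(2) by (cases u) (simp add: Fib_eq)
    have h: "h \<in> arr C" "src C h = src C b" "tgt C h = src C n"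
      "k \<in> arr C" "src C k = tgt C b" "tgt C k = tgt C n" "k \<cdot> b = n \<cdot> h" "n \<in> E"
      using u(1) un by (simp_all add: Fib_eq)
    have na: "n \<in> arr C" using fibE_arr[OF h(8)] .
    have e': "h \<cdot> x1 = h \<cdot> y1" "k \<cdot> x0 = k \<cdot> y0" using e un by (simp_all add: Fib_eq)
    obtain h' where h': "h' \<in> arr C" "src C h' = tgt C c" "tgt C h' = tgt C h" "h' \<cdot> c = h"
      by (rule C.coequaliser_factor[OF c h(1) _ e'(1)]) (use h x in simp_all)
    obtain k' where k': "k' \<in> arr C" "src C k' = tgt C d" "tgt C k' = tgt C k" "k' \<cdot> d = k"
      by (rule C.coequaliser_factor[OF d h(4) _ e'(2)]) (use h x in simp_all)
    have "k' \<cdot> g = n \<cdot> h'"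
    proof (rule C.coequaliser_epi[OF c])
      have "(k' \<cdot> g) \<cdot> c = k \<cdot> b"
        using k'(1-3) g Ea ca da h by (simp add: C.extend[OF k'(4)])
      also have "\<dots> = (n \<cdot> h') \<cdot> c" unfolding h(7) using h'(1-3) na h ca by (simp add: h'(4))
      finally show "(k' \<cdot> g) \<cdot> c = (n \<cdot> h') \<cdot> c" .
    qed (use k' h' h g Ea na in simp_all)
    then have "(g, h', k', n) \<in> arr (Fib \<Gamma>)" using k' h' h E Ea na g by (simp add: Fib_eq)
    moreover have "(g, h', k', n) \<cdot>\<^bsub>Fib \<Gamma>\<^esub> (b, c, d, g) = u" by (simp add: Fib_eq un h' k')
    ultimately show "\<exists>w \<in> hom (Fib \<Gamma>) (tgt (Fib \<Gamma>) (b, c, d, g)) (tgt (Fib \<Gamma>) u).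
        w \<cdot>\<^bsub>Fib \<Gamma>\<^esub> (b, c, d, g) = u"
      by (intro bexI[of _ "(g, h', k', n)"]) (simp_all add: hom_def Fib_eq un)
  next
    fix u v
    assume u: "u \<in> arr (Fib \<Gamma>)" "src (Fib \<Gamma>) u = tgt (Fib \<Gamma>) (b, c, d, g)"
      and v: "v \<in> arr (Fib \<Gamma>)" "src (Fib \<Gamma>) v = tgt (Fib \<Gamma>) (b, c, d, g)"
      and t: "tgt (Fib \<Gamma>) v = tgt (Fib \<Gamma>) u"
      and e: "u \<cdot>\<^bsub>Fib \<Gamma>\<^esub> (b, c, d, g) = v \<cdot>\<^bsub>Fib \<Gamma>\<^esub> (b, c, d, g)"
    obtain h k n where un: "u = (g, h, k, n)" using u(2) by (cases u) (simp add: Fib_eq)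
    obtain h' k' where vn: "v = (g, h', k', n)" using v(2) t by (cases v) (simp add: Fib_eq un)
    have h: "h \<in> arr C" "src C h = src C g" "tgt C h = src C n"
      "k \<in> arr C" "src C k = tgt C g" "tgt C k = tgt C n"
      using u(1) un by (simp_all add: Fib_eq)
    have h': "h' \<in> arr C" "src C h' = src C g" "tgt C h' = src C n"
      "k' \<in> arr C" "src C k' = tgt C g" "tgt C k' = tgt C n"
      using v(1) vn by (simp_all add: Fib_eq)
    have e': "h \<cdot> c = h' \<cdot> c" "k \<cdot> d = k' \<cdot> d" using e by (simp_all add: Fib_eq un vn)
    have "h = h'" by (rule C.coequaliser_epi[OF c _ _ _ _ _ e'(1)]) (use h h' g in simp_all)
    moreover have "k = k'" by (rule C.coequaliser_epi[OF d _ _ _ _ _ e'(2)]) (use h h' g in simp_all)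
    ultimately show "u = v" by (simp add: un vn)
  qed (use E Ea x y g ca da in \<open>simp_all add: Fib_eq\<close>)
qed

text \<open>
  The case \<open>k = 1\<close> is universality over a fixed base, the general case is universality among all
  fibrations.
\<close>

definition normal_reflection where
  "normal_reflection f f' u \<longleftrightarrow>
    normal_extension \<Gamma> f' \<and> tgt C f' = tgt C f \<and> u \<in> hom C (src C f) (src C f') \<and> f' \<cdot> u = f \<and>
    (\<forall>n h k. normal_extension \<Gamma> n \<longrightarrow> h \<in> hom C (src C f) (src C n) \<longrightarrow>
       k \<in> hom C (tgt C f) (tgt C n) \<longrightarrow> n \<cdot> h = k \<cdot> f \<longrightarrow>
       (\<exists>!w. w \<in> hom C (src C f') (src C n) \<and> w \<cdot> u = h \<and> n \<cdot> w = k \<cdot> f'))"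

text \<open>
  The coequaliser of the trivially reflected graph on the kernel pair, as described at the beginning.
  The arrow \<open>u\<close> sends \<open>a\<close> to the class of \<open>r (a, a)\<close>; that \<open>u q = c r\<close>, and hence that maps out of \<open>f'\<close>
  restrict correctly along \<open>u\<close>, holds because \<open>q\<close> is a split coequaliser of the graph from \<open>S\<close> to \<open>R\<close>.
\<close>

theorem normal_reflection_exists:
  assumes fE: "f \<in> E"
  obtains f' u where "normal_reflection f f' u"
proof -
  define A B where "A = src C f" and "B = tgt C f"
  have f: "f \<in> arr C" "src C f = A" "tgt C f = B" "A \<in> obj C" "B \<in> obj C"
    using fibE_arr[OF fE] by (simp_all add: A_def B_def)
  \<comment> \<open>In elements: \<open>R\<close> is the object of pairs and \<open>S\<close> the object of triples of elements of \<open>A\<close>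
    with the same image in \<open>B\<close>.\<close>
  obtain p q where R: "is_pullback C p q f f" using pullback_exists[of f f] f by auto
  define Ro where "Ro = src C p"
  note Ra = C.pullback_arr[OF R]
  have p: "p \<in> arr C" "src C p = Ro" "tgt C p = A" and q: "q \<in> arr C" "src C q = Ro" "tgt C q = A"
    and Ro: "Ro \<in> obj C" and fq: "f \<cdot> q = f \<cdot> p"
    using Ra f by (simp_all add: Ro_def)
  have pE: "p \<in> E" by (rule fibE_pullback[OF R fE])
  obtain p' s where S: "is_pullback C p' s (f \<cdot> p) f" using pullback_exists[of "f \<cdot> p" f] f p by auto
  define So where "So = src C p'"
  note Sa = C.pullback_arr[OF S]
  have p': "p' \<in> arr C" "src C p' = So" "tgt C p' = Ro" and s: "s \<in> arr C" "src C s = So" "tgt C s = A"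
    and So: "So \<in> obj C" and fs: "f \<cdot> s = f \<cdot> (p \<cdot> p')"
    using Sa f p by (simp_all add: So_def)
  have p'E: "p' \<in> E" by (rule fibE_pullback[OF S fE])
  \<comment> \<open>\<open>\<alpha>1 (a, b, c) = (a, c)\<close>, \<open>\<alpha>2 (a, b, c) = (b, c)\<close>, \<open>\<delta> a = (a, a)\<close>, \<open>\<sigma> (a, c) = (a, a, c)\<close>
    and \<open>z (a, c) = (a, c, c)\<close>.\<close>
  obtain \<alpha>1 where \<alpha>1: "\<alpha>1 \<in> arr C" "src C \<alpha>1 = So" "tgt C \<alpha>1 = Ro" "p \<cdot> \<alpha>1 = p \<cdot> p'" "q \<cdot> \<alpha>1 = s"
    unfolding Ro_def
    by (rule C.pullback_lift[OF R, of "p \<cdot> p'" So s]) (use f p p' s fs in \<open>simp_all add: hom_def\<close>)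
  obtain \<alpha>2 where \<alpha>2: "\<alpha>2 \<in> arr C" "src C \<alpha>2 = So" "tgt C \<alpha>2 = Ro" "p \<cdot> \<alpha>2 = q \<cdot> p'" "q \<cdot> \<alpha>2 = s"
    unfolding Ro_def
    by (rule C.pullback_lift[OF R, of "q \<cdot> p'" So s])
      (use f p q p' s in \<open>simp_all add: hom_def fs C.extend[OF fq]\<close>)
  obtain \<delta> where \<delta>: "\<delta> \<in> arr C" "src C \<delta> = A" "tgt C \<delta> = Ro" "p \<cdot> \<delta> = ide C A" "q \<cdot> \<delta> = ide C A"
    unfolding Ro_def
    by (rule C.pullback_lift[OF R, of "ide C A" A "ide C A"]) (use f in \<open>simp_all add: hom_def\<close>)
  obtain \<sigma> where \<sigma>: "\<sigma> \<in> arr C" "src C \<sigma> = Ro" "tgt C \<sigma> = So" "p' \<cdot> \<sigma> = \<delta> \<cdot> p" "s \<cdot> \<sigma> = q"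
    unfolding So_def
    by (rule C.pullback_lift[OF S, of "\<delta> \<cdot> p" Ro q])
      (use f p q \<delta>(1-3) in \<open>simp_all add: hom_def fq C.extend[OF \<delta>(4)]\<close>)
  obtain z where z: "z \<in> arr C" "src C z = Ro" "tgt C z = So" "p' \<cdot> z = ide C Ro" "s \<cdot> z = q"
    unfolding So_def
    by (rule C.pullback_lift[OF S, of "ide C Ro" Ro q]) (use f p q Ro in \<open>simp_all add: hom_def fq\<close>)
  have \<alpha>1\<sigma>: "\<alpha>1 \<cdot> \<sigma> = ide C Ro"
  proof (rule C.pullback_jointly_monic[OF R])
    show "p \<cdot> (\<alpha>1 \<cdot> \<sigma>) = p \<cdot> ide C Ro"
      using p p' \<alpha>1(1-3) \<sigma>(1-3) \<delta>(1-3) by (simp add: C.extend[OF \<alpha>1(4)] \<sigma>(4) C.extend[OF \<delta>(4)])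
    show "q \<cdot> (\<alpha>1 \<cdot> \<sigma>) = q \<cdot> ide C Ro"
      using q \<alpha>1(1-3) \<sigma>(1-3) by (simp add: C.extend[OF \<alpha>1(5)] \<sigma>(5))
  qed (use \<alpha>1(1-3) \<sigma>(1-3) Ro p in simp_all)
  have \<alpha>2\<sigma>: "\<alpha>2 \<cdot> \<sigma> = ide C Ro"
  proof (rule C.pullback_jointly_monic[OF R])
    show "p \<cdot> (\<alpha>2 \<cdot> \<sigma>) = p \<cdot> ide C Ro"
      using p q p' \<alpha>2(1-3) \<sigma>(1-3) \<delta>(1-3) by (simp add: C.extend[OF \<alpha>2(4)] \<sigma>(4) C.extend[OF \<delta>(5)])
    show "q \<cdot> (\<alpha>2 \<cdot> \<sigma>) = q \<cdot> ide C Ro"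
      using q \<alpha>2(1-3) \<sigma>(1-3) by (simp add: C.extend[OF \<alpha>2(5)] \<sigma>(5))
  qed (use \<alpha>2(1-3) \<sigma>(1-3) Ro p in simp_all)
  have \<alpha>1z: "\<alpha>1 \<cdot> z = ide C Ro"
  proof (rule C.pullback_jointly_monic[OF R])
    show "p \<cdot> (\<alpha>1 \<cdot> z) = p \<cdot> ide C Ro"
      using p p' \<alpha>1(1-3) z(1-3) by (simp add: C.extend[OF \<alpha>1(4)] z(4))
    show "q \<cdot> (\<alpha>1 \<cdot> z) = q \<cdot> ide C Ro"
      using q \<alpha>1(1-3) z(1-3) by (simp add: C.extend[OF \<alpha>1(5)] z(5))
  qed (use \<alpha>1(1-3) z(1-3) Ro p in simp_all)
  have \<alpha>2z: "\<alpha>2 \<cdot> z = \<delta> \<cdot> q"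
  proof (rule C.pullback_jointly_monic[OF R])
    show "p \<cdot> (\<alpha>2 \<cdot> z) = p \<cdot> (\<delta> \<cdot> q)"
      using p q p' \<alpha>2(1-3) z(1-3) \<delta>(1-3) by (simp add: C.extend[OF \<alpha>2(4)] z(4) C.extend[OF \<delta>(4)])
    show "q \<cdot> (\<alpha>2 \<cdot> z) = q \<cdot> (\<delta> \<cdot> q)"
      using q \<alpha>2(1-3) z(1-3) \<delta>(1-3) by (simp add: C.extend[OF \<alpha>2(5)] z(5) C.extend[OF \<delta>(5)])
  qed (use \<alpha>2(1-3) z(1-3) \<delta>(1-3) p q in simp_all)
  obtain t r where T: "trivial_reflection p t r" by (rule trivial_reflection_exists[OF pE])
  obtain t' r' where T': "trivial_reflection p' t' r'" by (rule trivial_reflection_exists[OF p'E])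
  define To To' where "To = src C t" and "To' = src C t'"
  note Ta = trivial_reflection_arr[OF T] and Ta' = trivial_reflection_arr[OF T']
  have t: "t \<in> E" "t \<in> arr C" "src C t = To" "tgt C t = A" "To \<in> obj C"
    and r: "r \<in> arr C" "src C r = Ro" "tgt C r = To" "t \<cdot> r = p"
    using Ta p by (simp_all add: To_def)
  have t': "t' \<in> E" "t' \<in> arr C" "src C t' = To'" "tgt C t' = Ro" "To' \<in> obj C"
    and r': "r' \<in> arr C" "src C r' = So" "tgt C r' = To'" "t' \<cdot> r' = p'"
    using Ta' p' by (simp_all add: To'_def)
  have triv: "trivial_extension \<Gamma> t" "trivial_extension \<Gamma> t'"
    using T T' by (simp_all add: trivial_reflection_def)
  obtain \<beta>1 where \<beta>1: "\<beta>1 \<in> arr C" "src C \<beta>1 = To'" "tgt C \<beta>1 = To" "\<beta>1 \<cdot> r' = r \<cdot> \<alpha>1"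
    "t \<cdot> \<beta>1 = p \<cdot> t'"
    unfolding To_def To'_def
    by (rule trivial_reflection_lift[OF T' triv(1), of "r \<cdot> \<alpha>1" p])
      (use p p' r t \<alpha>1 in \<open>simp_all add: hom_def C.extend[OF r(4)]\<close>)
  obtain \<beta>2 where \<beta>2: "\<beta>2 \<in> arr C" "src C \<beta>2 = To'" "tgt C \<beta>2 = To" "\<beta>2 \<cdot> r' = r \<cdot> \<alpha>2"
    "t \<cdot> \<beta>2 = q \<cdot> t'"
    unfolding To_def To'_def
    by (rule trivial_reflection_lift[OF T' triv(1), of "r \<cdot> \<alpha>2" q])
      (use p q p' r t \<alpha>2 in \<open>simp_all add: hom_def C.extend[OF r(4)]\<close>)
  obtain \<tau> where \<tau>: "\<tau> \<in> arr C" "src C \<tau> = To" "tgt C \<tau> = To'" "\<tau> \<cdot> r = r' \<cdot> \<sigma>"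
    "t' \<cdot> \<tau> = \<delta> \<cdot> t"
    unfolding To_def To'_def
    by (rule trivial_reflection_lift[OF T triv(2), of "r' \<cdot> \<sigma>" \<delta>])
      (use p p' r' t' \<sigma> \<delta> in \<open>simp_all add: hom_def C.extend[OF r'(4)]\<close>)
  have \<beta>1\<tau>: "\<beta>1 \<cdot> \<tau> = ide C To"
  proof (rule trivial_reflection_unique[OF T triv(1), of "ide C A"])
    show "t \<cdot> (\<beta>1 \<cdot> \<tau>) = ide C A \<cdot> t"
      using t t' \<beta>1(1-3) \<tau>(1-3) p \<delta>(1-3)
      by (simp add: C.extend[OF \<beta>1(5)] \<tau>(5) C.extend[OF \<delta>(4)])
    show "(\<beta>1 \<cdot> \<tau>) \<cdot> r = ide C To \<cdot> r"
      using r r' \<beta>1(1-3) \<tau>(1-3) \<alpha>1(1-3) \<sigma>(1-3) by (simp add: \<tau>(4) C.extend[OF \<beta>1(4)] \<alpha>1\<sigma>)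
  qed (use t p f \<beta>1(1-3) \<tau>(1-3) in \<open>simp_all add: hom_def\<close>)
  have \<beta>2\<tau>: "\<beta>2 \<cdot> \<tau> = ide C To"
  proof (rule trivial_reflection_unique[OF T triv(1), of "ide C A"])
    show "t \<cdot> (\<beta>2 \<cdot> \<tau>) = ide C A \<cdot> t"
      using t t' \<beta>2(1-3) \<tau>(1-3) q \<delta>(1-3)
      by (simp add: C.extend[OF \<beta>2(5)] \<tau>(5) C.extend[OF \<delta>(5)])
    show "(\<beta>2 \<cdot> \<tau>) \<cdot> r = ide C To \<cdot> r"
      using r r' \<beta>2(1-3) \<tau>(1-3) \<alpha>2(1-3) \<sigma>(1-3) by (simp add: \<tau>(4) C.extend[OF \<beta>2(4)] \<alpha>2\<sigma>)
  qed (use t p f \<beta>2(1-3) \<tau>(1-3) in \<open>simp_all add: hom_def\<close>)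
  have "is_reflexive_graph C \<beta>1 \<beta>2"
    unfolding is_reflexive_graph_def using \<beta>1(1-3) \<beta>2(1-3) \<tau>(1-3) \<beta>1\<tau> \<beta>2\<tau>
    by (auto simp: hom_def)
  then obtain c where c: "is_coequaliser C \<beta>1 \<beta>2 c"
    using reflexive_coequalisers unfolding has_reflexive_coequalisers_def by blast
  define A' where "A' = tgt C c"
  have ca: "c \<in> arr C" "src C c = To" "tgt C c = A'" "c \<cdot> \<beta>2 = c \<cdot> \<beta>1" "A' \<in> obj C"
    using c \<beta>1(1-3) by (simp_all add: is_coequaliser_def A'_def)
  have fc: "is_coequaliser C p q f"
    by (rule C.regular_epi_is_coequaliser_of_kernel_pair)
      (use fE R in \<open>simp_all add: fib_reg[symmetric] is_kernel_pair_def\<close>)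
  have "(f \<cdot> t) \<cdot> \<beta>1 = (f \<cdot> t) \<cdot> \<beta>2"
    using f t \<beta>1 \<beta>2 t' p q by (simp add: C.extend[OF fq])
  then obtain f' where f': "f' \<in> arr C" "src C f' = A'" "tgt C f' = B" "f' \<cdot> c = f \<cdot> t"
    by (rule C.coequaliser_factor[OF c, rotated -2]) (use f t \<beta>1 A'_def in simp_all)
  have f'E: "f' \<in> E"
    unfolding fib_reg
    by (rule C.regular_epi_cancel[OF f'(1) c])
      (use fibE_cmp[OF t(1) fE] f' f t ca in \<open>simp_all add: fib_reg[symmetric]\<close>)
  have x: "(t', \<beta>1, p, t) \<in> arr (arrow_cat C)" and y: "(t', \<beta>2, q, t) \<in> arr (arrow_cat C)"
    using t t' \<beta>1 \<beta>2 p q by simp_all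
  have cF: "is_coequaliser (Fib \<Gamma>) (t', \<beta>1, p, t) (t', \<beta>2, q, t) (t, c, f, f')"
    by (rule coequaliser_in_Fib[OF t'(1) t(1) f'E c fc x y]) (use f' f ca in simp_all)
  have "(t, \<tau>, \<delta>, t') \<in> arr (arrow_cat C)" using t t' \<tau> \<delta> by simp
  then have "is_reflexive_graph (Fib \<Gamma>) (t', \<beta>1, p, t) (t', \<beta>2, q, t)"
    unfolding is_reflexive_graph_def using x y t t' \<beta>1\<tau> \<beta>2\<tau> \<delta>(4,5)
    by (intro conjI bexI[of _ "(t, \<tau>, \<delta>, t')"]) (simp_all add: Fib_eq hom_def)
  moreover have "t \<in> obj (Norm \<Gamma>)" "t' \<in> obj (Norm \<Gamma>)"
    using t t' triv[THEN trivial_imp_normal] by (simp_all add: Norm_def Fib_eq)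
  ultimately have "f' \<in> obj (Norm \<Gamma>)"
    using closed[unfolded closed_under_reflexive_coequalisers_def, rule_format, of
      "(t', \<beta>1, p, t)" "(t', \<beta>2, q, t)" "(t, c, f, f')"] cF by (simp add: Fib_eq)
  then have nf': "normal_extension \<Gamma> f'" by (simp add: Norm_def)
  define u where "u = c \<cdot> (r \<cdot> \<delta>)"
  have u: "u \<in> arr C" "src C u = A" "tgt C u = A'" using ca r \<delta> by (simp_all add: u_def)
  \<comment> \<open>\<open>c r\<close> coequalises \<open>\<alpha>1\<close> and \<open>\<alpha>2\<close>, whose split coequaliser is \<open>q\<close>.\<close>
  have cr\<alpha>: "c \<cdot> (r \<cdot> \<alpha>1) = c \<cdot> (r \<cdot> \<alpha>2)"
    using \<beta>1(1-3) \<beta>2(1-3) r' ca by (simp add: \<beta>1(4)[symmetric] \<beta>2(4)[symmetric] C.extend[OF ca(4)])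
  have uq: "u \<cdot> q = c \<cdot> r"
  proof -
    have "u \<cdot> q = (c \<cdot> (r \<cdot> \<alpha>2)) \<cdot> z"
      unfolding u_def using ca(1-3) r(1-3) \<delta>(1-3) q \<alpha>2(1-3) z(1-3) by (simp add: \<alpha>2z)
    also have "\<dots> = c \<cdot> r"
      unfolding cr\<alpha>[symmetric] using ca(1-3) r(1-3) \<alpha>1(1-3) z(1-3) by (simp add: \<alpha>1z)
    finally show ?thesis .
  qed
  have f'u: "f' \<cdot> u = f"
    unfolding u_def using f'(1-3) ca(1-3) r(1-3) \<delta>(1-3) f t
    by (simp add: C.extend[OF f'(4)] C.extend[OF r(4)] \<delta>(4))
  have "normal_reflection f f' u"
    unfolding normal_reflection_def
  proof (intro conjI allI impI)
    fix n h k
    assume n: "normal_extension \<Gamma> n" and "h \<in> hom C (src C f) (src C n)"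
      "k \<in> hom C (tgt C f) (tgt C n)" and e: "n \<cdot> h = k \<cdot> f"
    then have h: "h \<in> arr C" "src C h = A" "tgt C h = src C n"
      and k: "k \<in> arr C" "src C k = B" "tgt C k = tgt C n"
      using f by (simp_all add: hom_def)
    have na: "n \<in> arr C" using n fibE_arr by (simp add: normal_extension_def)
    obtain y where y: "y \<in> arr C" "src C y = To" "tgt C y = src C n" "y \<cdot> r = h \<cdot> q"
      "n \<cdot> y = n \<cdot> (h \<cdot> t)"
      unfolding To_def
      by (rule normal_lift[OF T n, of "h \<cdot> q" h])
        (use h p q f k na in \<open>simp_all add: hom_def C.extend[OF e] fq\<close>)
    \<comment> \<open>\<open>y \<beta>2\<close> lies over \<open>n h q t'\<close>, which equals \<open>n h p t'\<close> because \<open>n h q = k f q = k f p\<close>. So both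
      composites belong to the same arrow \<open>h p\<close> from the base into the domain of \<open>n\<close>.\<close>
    have "y \<cdot> \<beta>1 = y \<cdot> \<beta>2"
    proof (rule normal_unique[OF T' n, of "h \<cdot> p"])
      show "n \<cdot> (y \<cdot> \<beta>1) = n \<cdot> ((h \<cdot> p) \<cdot> t')"
        using y(1-3) \<beta>1(1-3) na h t t' p by (simp add: C.extend[OF y(5)] \<beta>1(5))
      show "n \<cdot> (y \<cdot> \<beta>2) = n \<cdot> ((h \<cdot> p) \<cdot> t')"
        using y(1-3) \<beta>2(1-3) na h t t' p q f k
        by (simp add: C.extend[OF y(5)] \<beta>2(5) C.extend[OF e] C.extend[OF fq])
      show "(y \<cdot> \<beta>1) \<cdot> r' = (y \<cdot> \<beta>2) \<cdot> r'"
        using y(1-3) \<beta>1(1-3) \<beta>2(1-3) r(1-3) r'(1-3) \<alpha>1(1-3) \<alpha>2(1-3) h q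
        by (simp add: \<beta>1(4) \<beta>2(4) C.extend[OF y(4)] \<alpha>1(5) \<alpha>2(5))
    qed (use y(1-3) \<beta>1(1-3) \<beta>2(1-3) h p p' t' in \<open>simp_all add: hom_def\<close>)
    then obtain w where w: "w \<in> arr C" "src C w = A'" "tgt C w = src C n" "w \<cdot> c = y"
      unfolding A'_def y(3)[symmetric]
      by (rule C.coequaliser_factor[OF c, rotated -2]) (use y \<beta>1 in simp_all)
    have nw: "n \<cdot> w = k \<cdot> f'"
    proof (rule C.coequaliser_epi[OF c])
      show "(n \<cdot> w) \<cdot> c = (k \<cdot> f') \<cdot> c"
        using na w f'(1-3) k ca(1-3) f t h by (simp add: y(5) C.extend[OF e] f'(4))
    qed (use na w f'(1-3) k ca(1-3) in simp_all)
    have wu: "w \<cdot> u = h"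
      unfolding u_def using w(1-3) ca(1-3) r(1-3) \<delta>(1-3) y(1-3) h q
      by (simp add: C.extend[OF w(4)] C.extend[OF y(4)] \<delta>(5))
    show "\<exists>!w. w \<in> hom C (src C f') (src C n) \<and> w \<cdot> u = h \<and> n \<cdot> w = k \<cdot> f'"
    proof (rule ex1I[of _ w])
      fix w' assume "w' \<in> hom C (src C f') (src C n) \<and> w' \<cdot> u = h \<and> n \<cdot> w' = k \<cdot> f'"
      then have w': "w' \<in> arr C" "src C w' = A'" "tgt C w' = src C n" "w' \<cdot> u = h" "n \<cdot> w' = k \<cdot> f'"
        using f' by (simp_all add: hom_def)
      \<comment> \<open>Any solution composed with \<open>c\<close> is an extension of \<open>h q\<close> along \<open>r\<close>, and these are unique.\<close>
      have along: "n \<cdot> (v \<cdot> c) = n \<cdot> (h \<cdot> t)" "(v \<cdot> c) \<cdot> r = h \<cdot> q"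
        if v: "v \<in> arr C" "src C v = A'" "tgt C v = src C n" "v \<cdot> u = h" "n \<cdot> v = k \<cdot> f'" for v
      proof -
        show "n \<cdot> (v \<cdot> c) = n \<cdot> (h \<cdot> t)"
          using v(1-3) na ca(1-3) f'(1-3) k h f t
          by (simp add: C.extend[OF v(5)] f'(4) C.extend[OF e])
        show "(v \<cdot> c) \<cdot> r = h \<cdot> q"
          using v(1-3) ca(1-3) r(1-3) u q by (simp add: uq[symmetric] C.extend[OF v(4)])
      qed
      have "w' \<cdot> c = w \<cdot> c"
        by (rule normal_unique[OF T n, of h])
          (use along[OF w'] along[OF w(1-3) wu nw] w'(1-3) w(1-3) h ca t p in \<open>simp_all add: hom_def\<close>)
      then show "w' = w"
        by (rule C.coequaliser_epi[OF c, rotated -1]) (use w w' ca in simp_all)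
    qed (use w wu nw f' in \<open>simp add: hom_def\<close>)
  qed (use u f f' nf' f'u in \<open>simp_all add: hom_def\<close>)
  then show ?thesis by (rule that)
qed

subsection \<open>Reflectivity\<close>

text \<open>
  Arrows over \<open>B\<close> correspond to squares whose bottom is the identity of \<open>B\<close>.
\<close>

lemma Norm_over_reflective: "reflective_subcategory (Norm_over \<Gamma> B) (Fib_over \<Gamma> B)"
proof -
  interpret S: category "Fib_over \<Gamma> B"
    unfolding Fib_over_def by (simp add: category.category_full_subcat[OF C.category_slice])
  show ?thesis
    unfolding Norm_over_def
  proof (rule S.reflective_of_universal_arrows)
    fix f assume "f \<in> obj (Fib_over \<Gamma> B)"
    then have f: "f \<in> E" "f \<in> arr C" "tgt C f = B" by (simp_all add: Fib_over_def)
    obtain f' u where R: "normal_reflection f f' u" by (rule normal_reflection_exists[OF f(1)])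
    then have f': "normal_extension \<Gamma> f'" "tgt C f' = tgt C f" "u \<in> hom C (src C f) (src C f')"
      "f' \<cdot> u = f"
      by (simp_all add: normal_reflection_def)
    have f'a: "f' \<in> E" "f' \<in> arr C" "tgt C f' = B"
      using f'(1,2) f fibE_arr by (simp_all add: normal_extension_def)
    have ua: "u \<in> arr C" "src C u = src C f" "tgt C u = src C f'"
      using f'(3) by (simp_all add: hom_def)
    have "\<exists>!g. g \<in> hom (Fib_over \<Gamma> B) f' n \<and> g \<cdot>\<^bsub>Fib_over \<Gamma> B\<^esub> (f, u, f') = x"
      if n: "normal_extension \<Gamma> n" and x: "x \<in> hom (Fib_over \<Gamma> B) f n" for n x
    proof -
      obtain h where xh: "x = (f, h, n)" using x by (cases x) (simp add: hom_def Fib_over_def)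
      have h: "h \<in> arr C" "src C h = src C f" "tgt C h = src C n" "n \<cdot> h = f"
        and na: "n \<in> E" "n \<in> arr C" "tgt C n = B"
        using x by (simp_all add: xh hom_def Fib_over_def)
      have "\<exists>!w. w \<in> hom C (src C f') (src C n) \<and> w \<cdot> u = h \<and> n \<cdot> w = ide C B \<cdot> f'"
        using R n h na f C.tgt_obj[OF f(2)] by (simp add: normal_reflection_def hom_def)
      then obtain w where w: "w \<in> hom C (src C f') (src C n)" "w \<cdot> u = h" "n \<cdot> w = ide C B \<cdot> f'"
        and uniq: "\<And>w'. \<lbrakk>w' \<in> hom C (src C f') (src C n); w' \<cdot> u = h; n \<cdot> w' = ide C B \<cdot> f'\<rbrakk>
          \<Longrightarrow> w' = w"
        by blast
      show ?thesis
      proof (rule ex1I[of _ "(f', w, n)"])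
        fix g assume g: "g \<in> hom (Fib_over \<Gamma> B) f' n \<and> g \<cdot>\<^bsub>Fib_over \<Gamma> B\<^esub> (f, u, f') = x"
        then obtain w' where gw: "g = (f', w', n)" by (cases g) (simp add: hom_def Fib_over_def)
        have "w' = w" by (rule uniq) (use g in \<open>simp_all add: gw xh hom_def Fib_over_def f'a\<close>)
        then show "g = (f', w, n)" by (simp add: gw)
      qed (use w f'a na in \<open>simp add: hom_def Fib_over_def xh\<close>)
    qed
    then show "\<exists>f' \<in> obj (Fib_over \<Gamma> B) \<inter> {f. normal_extension \<Gamma> f}. \<exists>u \<in> hom (Fib_over \<Gamma> B) f f'.
      \<forall>n \<in> obj (Fib_over \<Gamma> B) \<inter> {f. normal_extension \<Gamma> f}. \<forall>x \<in> hom (Fib_over \<Gamma> B) f n.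
        \<exists>!g. g \<in> hom (Fib_over \<Gamma> B) f' n \<and> g \<cdot>\<^bsub>Fib_over \<Gamma> B\<^esub> u = x"
      using f f'(1,4) f'a ua
      by (intro bexI[of _ f'] bexI[of _ "(f, u, f')"] ballI) (simp_all add: hom_def Fib_over_def)
  qed
qed

lemma Norm_reflective: "reflective_subcategory (Norm \<Gamma>) (Fib \<Gamma>)"
proof -
  interpret S: category "Fib \<Gamma>" by (rule category_Fib)
  show ?thesis
    unfolding Norm_def
  proof (rule S.reflective_of_universal_arrows)
    fix f assume "f \<in> obj (Fib \<Gamma>)"
    then have f: "f \<in> E" "f \<in> arr C" by (simp_all add: Fib_eq)
    obtain f' u where R: "normal_reflection f f' u" by (rule normal_reflection_exists[OF f(1)])
    then have f': "normal_extension \<Gamma> f'" "tgt C f' = tgt C f" "u \<in> hom C (src C f) (src C f')"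
      "f' \<cdot> u = f"
      by (simp_all add: normal_reflection_def)
    define B where "B = tgt C f"
    have f'a: "f' \<in> E" "f' \<in> arr C" "tgt C f' = B" "tgt C f = B" "B \<in> obj C"
      using f'(1,2) f fibE_arr by (simp_all add: normal_extension_def B_def)
    have ua: "u \<in> arr C" "src C u = src C f" "tgt C u = src C f'"
      using f'(3) by (simp_all add: hom_def)
    have "\<exists>!g. g \<in> hom (Fib \<Gamma>) f' n \<and> g \<cdot>\<^bsub>Fib \<Gamma>\<^esub> (f, u, ide C B, f') = x"
      if n: "normal_extension \<Gamma> n" and x: "x \<in> hom (Fib \<Gamma>) f n" for n x
    proof -
      obtain h k where xh: "x = (f, h, k, n)" using x by (cases x) (simp add: hom_def Fib_eq)
      have h: "h \<in> arr C" "src C h = src C f" "tgt C h = src C n" "n \<cdot> h = k \<cdot> f"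
        and k: "k \<in> arr C" "src C k = B" "tgt C k = tgt C n"
        and na: "n \<in> E" "n \<in> arr C"
        using x f'a by (simp_all add: xh hom_def Fib_eq)
      have "\<exists>!w. w \<in> hom C (src C f') (src C n) \<and> w \<cdot> u = h \<and> n \<cdot> w = k \<cdot> f'"
        using R n h k f'a by (simp add: normal_reflection_def hom_def)
      then obtain w where w: "w \<in> hom C (src C f') (src C n)" "w \<cdot> u = h" "n \<cdot> w = k \<cdot> f'"
        and uniq: "\<And>w'. \<lbrakk>w' \<in> hom C (src C f') (src C n); w' \<cdot> u = h; n \<cdot> w' = k \<cdot> f'\<rbrakk>
          \<Longrightarrow> w' = w"
        by blast
      show ?thesis
      proof (rule ex1I[of _ "(f', w, k, n)"])
        fix g assume g: "g \<in> hom (Fib \<Gamma>) f' n \<and> g \<cdot>\<^bsub>Fib \<Gamma>\<^esub> (f, u, ide C B, f') = x"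
        then obtain w' k' where gw: "g = (f', w', k', n)" by (cases g) (simp add: hom_def Fib_eq)
        have "k' \<in> arr C" "src C k' = B" "k' \<cdot> ide C B = k"
          using g f'a by (simp_all add: gw xh hom_def Fib_eq)
        then have k': "k' = k" by simp
        have "w' = w" by (rule uniq) (use g in \<open>simp_all add: gw k' xh hom_def Fib_eq\<close>)
        then show "g = (f', w, k, n)" by (simp add: gw k')
      qed (use w k f'a na in \<open>simp add: hom_def Fib_eq xh\<close>)
    qed
    then show "\<exists>f' \<in> obj (Fib \<Gamma>) \<inter> {f. normal_extension \<Gamma> f}. \<exists>u \<in> hom (Fib \<Gamma>) f f'.
      \<forall>n \<in> obj (Fib \<Gamma>) \<inter> {f. normal_extension \<Gamma> f}. \<forall>x \<in> hom (Fib \<Gamma>) f n.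
        \<exists>!g. g \<in> hom (Fib \<Gamma>) f' n \<and> g \<cdot>\<^bsub>Fib \<Gamma>\<^esub> u = x"
      using f f'(1,4) f'a ua
      by (intro bexI[of _ f'] bexI[of _ "(f, u, ide C B, f')"] ballI) (simp_all add: hom_def Fib_eq)
  qed
qed

end

theorem theorem2p10:
  fixes \<Gamma> :: "('o, 'a, 'p, 'b) galois"
  assumes "galois_structure \<Gamma>"
    and "fibE \<Gamma> = regular_epis (catC \<Gamma>)"
    and "fibF \<Gamma> = regular_epis (catX \<Gamma>)"
    and "has_reflexive_coequalisers (catC \<Gamma>)"
    and "admissible \<Gamma>"
    and "closed_under_reflexive_coequalisers (Norm \<Gamma>) (Fib \<Gamma>)"
  shows "(\<forall>B \<in> obj (catC \<Gamma>). reflective_subcategory (Norm_over \<Gamma> B) (Fib_over \<Gamma> B)) \<and>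
    reflective_subcategory (Norm \<Gamma>) (Fib \<Gamma>)"
proof (cases \<Gamma>)
  case (fields C X I H \<eta> \<epsilon> E F)
  interpret normal_galois C X I H \<eta> \<epsilon> E F
    using assms unfolding fields by unfold_locales (simp_all add: galois_structure_def)
  show ?thesis unfolding fields using Norm_over_reflective Norm_reflective by simp
qed

end
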